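(* Let $d\ge1$, let $\Lambda\subseteq\mathbb Z^d$ be a finite connected subset, $\beta>0$, and consider the Glauber dynamics of the Ising model on $\Omega=\{-1,1\}^\Lambda$. Assume that $$2d\,(1-\exp(-2\beta))\exp(4d\beta)\le1 .$$ Let $$\kappa=2-2d(1-\exp(-2\beta))\exp(2\beta d),\qquad\bar\kappa=\exp(-2\beta d)-2d(1-\exp(-2\beta))\exp(2\beta d).$$ Then: (i) for every admissible $\phi$ the convex Sobolev inequality holds with $\kappa_\phi=\kappa$; (ii) the modified logarithmic Sobolev inequality holds with $\kappa_1=\kappa+2\bar\kappa$; (iii) for every $\alpha\in(1,2]$ the Beckner inequality holds with $\kappa_\alpha=\alpha\kappa$.
   Context: Ising model: $\Lambda$ carries the graph structure inherited from the nearest-neighbour graph $\mathbb Z^d$, and $x\sim y$ means that $x,y\in\Lambda$ are neighbours. Hamiltonian $H(\eta)=-\frac12\sum_{x\sim y}\eta_x\eta_y$ (sum over ordered pairs of neighbours). Moves $G=\{\sigma_x\}_{x\in\Lambda}$, where $\sigma_x$ flips the sign of the spin at $x$. Rates $c(\eta,\sigma_x)=\exp(-\frac\beta2(H(\sigma_x\eta)-H(\eta)))=\exp\big(-\beta\eta_x\sum_{y\sim x}\eta_y\big)$; generator $\mathcal Lf(\eta)=\sum_xc(\eta,\sigma_x)(f(\sigma_x\eta)-f(\eta))$; reversible probability measure $\mathbf m(\eta)=\frac1{Z_\beta}\exp(-\beta H(\eta))$. $\phi:[0,\infty)\to[0,\infty)$ is admissible if it is convex, twice differentiable on $(0,\infty)$,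 and $\Phi(a,b):=(\phi'(b)-\phi'(a))(b-a)$ is convex on $(0,\infty)^2$. $\mathcal H^\phi(f|\mathbf m)=\sum_\eta\phi(f(\eta))\mathbf m(\eta)-\phi\big(\sum_\eta f(\eta)\mathbf m(\eta)\big)$. The convex Sobolev inequality with constant $\kappa_\phi$ is: for all $f:\Omega\to(0,\infty)$, $$\kappa_\phi\,\mathcal H^\phi(f|\mathbf m)\le\frac12\sum_{\eta\in\Omega,\sigma\in G}c(\eta,\sigma)\,\Phi(f(\eta),f(\sigma\eta))\,\mathbf m(\eta).$$ Let $\phi_1(a)=a\log a-a+1$ and $\phi_\alpha(a)=\frac{1}{\alpha-1}(a^\alpha-a)-a+1$ for $\alpha\in(1,2]$. The modified logarithmic Sobolev inequality with constant $\kappa_1$ is the convex Sobolev inequality for $\phi=\phi_1$; the Beckner inequality with constant $\kappa_\alpha$ is the one for $\phi=\phi_\alpha$. *)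

theory Defs
  imports "HOL-Analysis.Analysis"
begin

section \<open>Convex Sobolev inequalities\<close>

definition Phi :: "(real \<Rightarrow> real) \<Rightarrow> real \<Rightarrow> real \<Rightarrow> real" where
  "Phi \<phi> a b = (deriv \<phi> b - deriv \<phi> a) * (b - a)"

text \<open>A function on \<open>[0, \<infinity>)\<close> is represented by a function on all reals; only its values on
  \<open>[0, \<infinity>)\<close> matter below.\<close>

definition admissible :: "(real \<Rightarrow> real) \<Rightarrow> bool" where
  "admissible \<phi> \<longleftrightarrow>
     (\<forall>a\<ge>0. 0 \<le> \<phi> a) \<and>
     convex_on {0..} \<phi> \<and>
     (\<forall>a>0. \<phi> differentiable (at a) \<and> deriv \<phi> differentiable (at a)) \<and>
     convex_on ({0<..} \<times> {0<..}) (\<lambda>(a, b). Phi \<phi> a b)"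

definition phi_entropy :: "'s set \<Rightarrow> ('s \<Rightarrow> real) \<Rightarrow> (real \<Rightarrow> real) \<Rightarrow> ('s \<Rightarrow> real) \<Rightarrow> real" where
  "phi_entropy \<Omega> m \<phi> f = (\<Sum>\<eta>\<in>\<Omega>. \<phi> (f \<eta>) * m \<eta>) - \<phi> (\<Sum>\<eta>\<in>\<Omega>. f \<eta> * m \<eta>)"

definition convex_sobolev ::
  "'s set \<Rightarrow> ('s \<Rightarrow> 's) set \<Rightarrow> ('s \<Rightarrow> ('s \<Rightarrow> 's) \<Rightarrow> real) \<Rightarrow> ('s \<Rightarrow> real) \<Rightarrow> (real \<Rightarrow> real) \<Rightarrow> real \<Rightarrow> bool"
where
  "convex_sobolev \<Omega> G c m \<phi> K \<longleftrightarrow>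
     (\<forall>f. (\<forall>\<eta>\<in>\<Omega>. 0 < f \<eta>) \<longrightarrow>
       K * phi_entropy \<Omega> m \<phi> f
         \<le> 1 / 2 * (\<Sum>\<eta>\<in>\<Omega>. \<Sum>\<sigma>\<in>G. c \<eta> \<sigma> * Phi \<phi> (f \<eta>) (f (\<sigma> \<eta>)) * m \<eta>))"

text \<open>At \<open>a = 0\<close> the library conventions \<open>ln 0 = 0\<close> and \<open>0 powr \<alpha> = 0\<close> give the usual
  values \<open>\<phi>\<^sub>1(0) = \<phi>\<^sub>\<alpha>(0) = 1\<close>.\<close>

definition phi_log :: "real \<Rightarrow> real" where
  "phi_log a = a * ln a - a + 1"

definition phi_power :: "real \<Rightarrow> real \<Rightarrow> real" where
  "phi_power \<alpha> a = 1 / (\<alpha> - 1) * (a powr \<alpha> - a) - a + 1"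

definition modified_log_sobolev ::
  "'s set \<Rightarrow> ('s \<Rightarrow> 's) set \<Rightarrow> ('s \<Rightarrow> ('s \<Rightarrow> 's) \<Rightarrow> real) \<Rightarrow> ('s \<Rightarrow> real) \<Rightarrow> real \<Rightarrow> bool"
where
  "modified_log_sobolev \<Omega> G c m K \<longleftrightarrow> convex_sobolev \<Omega> G c m phi_log K"

definition beckner ::
  "'s set \<Rightarrow> ('s \<Rightarrow> 's) set \<Rightarrow> ('s \<Rightarrow> ('s \<Rightarrow> 's) \<Rightarrow> real) \<Rightarrow> ('s \<Rightarrow> real) \<Rightarrow> real \<Rightarrow> real \<Rightarrow> bool"
where
  "beckner \<Omega> G c m \<alpha> K \<longleftrightarrow> convex_sobolev \<Omega> G c m (phi_power \<alpha>) K"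

section \<open>Glauber dynamics of the Ising model\<close>

text \<open>The lattice \<open>\<int>\<^sup>d\<close> is \<^typ>\<open>int ^ 'd\<close> with \<open>d = CARD('d)\<close>, so \<open>d \<ge> 1\<close> automatically.\<close>

definition nbr :: "int ^ 'd \<Rightarrow> int ^ 'd \<Rightarrow> bool" where
  "nbr x y \<longleftrightarrow> (\<Sum>i\<in>UNIV. \<bar>x $ i - y $ i\<bar>) = 1"

definition lattice_connected :: "(int ^ 'd) set \<Rightarrow> bool" where
  "lattice_connected \<Lambda> \<longleftrightarrow>
     (\<forall>x\<in>\<Lambda>. \<forall>y\<in>\<Lambda>. (\<lambda>u v. u \<in> \<Lambda> \<and> v \<in> \<Lambda> \<and> nbr u v)\<^sup>*\<^sup>* x y)"

text \<open>Spins are real numbers; a configuration on \<open>\<Lambda>\<close> is an extensional function, so that the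
  configuration space has exactly \<open>2 ^ card \<Lambda>\<close> elements.\<close>

type_synonym 'd config = "int ^ 'd \<Rightarrow> real"

definition configs :: "(int ^ 'd) set \<Rightarrow> 'd config set" where
  "configs \<Lambda> = (\<Lambda> \<rightarrow>\<^sub>E {-1, 1})"

definition flip :: "int ^ 'd \<Rightarrow> 'd config \<Rightarrow> 'd config" where
  "flip x \<eta> = \<eta>(x := - \<eta> x)"

definition moves :: "(int ^ 'd) set \<Rightarrow> ('d config \<Rightarrow> 'd config) set" where
  "moves \<Lambda> = flip ` \<Lambda>"

text \<open>The sum runs over ordered pairs, so every edge is counted twice.\<close>

definition hamiltonian :: "(int ^ 'd) set \<Rightarrow> 'd config \<Rightarrow> real" where
  "hamiltonian \<Lambda> \<eta> = - (1 / 2) * (\<Sum>(x, y) | x \<in> \<Lambda> \<and> y \<in> \<Lambda> \<and> nbr x y. \<eta> x * \<eta> y)"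

definition rate :: "(int ^ 'd) set \<Rightarrow> real \<Rightarrow> 'd config \<Rightarrow> ('d config \<Rightarrow> 'd config) \<Rightarrow> real" where
  "rate \<Lambda> \<beta> \<eta> \<sigma> = exp (- (\<beta> / 2) * (hamiltonian \<Lambda> (\<sigma> \<eta>) - hamiltonian \<Lambda> \<eta>))"

definition partition_fun :: "(int ^ 'd) set \<Rightarrow> real \<Rightarrow> real" where
  "partition_fun \<Lambda> \<beta> = (\<Sum>\<eta>\<in>configs \<Lambda>. exp (- \<beta> * hamiltonian \<Lambda> \<eta>))"

definition gibbs :: "(int ^ 'd) set \<Rightarrow> real \<Rightarrow> 'd config \<Rightarrow> real" where
  "gibbs \<Lambda> \<beta> \<eta> = 1 / partition_fun \<Lambda> \<beta> * exp (- \<beta> * hamiltonian \<Lambda> \<eta>)"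

end

theory Submission
  imports Defs
begin

text \<open>Couple the dynamics started at \<open>\<eta>\<close> and at its neighbour \<open>\<eta>\<^sup>x\<close> so that the two copies either stay neighbours
  or merge.  Convexity of \<open>\<Phi>\<close> bounds the derivative of the Fisher information
  \<open>I(f) = 1/2 \<Sum> c \<Phi> m\<close> along the flow by the expected change of \<open>\<Phi>\<close> under the coupling.  By reversibility
  the moves made in parallel contribute nothing, and the excess moves, of total rate at most
  \<open>K = 2d (1 - e\<^bsup>-2\<beta>\<^esup>) e\<^bsup>2d\<beta>\<^esup>\<close>, contribute at most \<open>K I(f)\<close>, while the merging moves and the loss terms give
  \<open>-2 I(f)\<close> for a general \<open>\<phi>\<close>.  For \<open>\<phi>\<^sub>\<alpha>\<close> a merging move decreases \<open>\<Phi>\<close> at rate \<open>\<alpha> \<Phi>\<close> instead of \<open>\<Phi>\<close>;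
  for \<open>\<phi>\<^sub>1\<close> the two opposite merging moves at equal rates decrease it at rate \<open>4 \<Phi>\<close> instead of \<open>2 \<Phi>\<close>, and
  each of them has rate at least \<open>e\<^bsup>-2d\<beta>\<^esup> - K\<close>.\<close>

section \<open>Bounds on the directional derivative of \<open>\<Phi>\<close>\<close>

text \<open>The differential of \<open>Phi \<phi>\<close> at \<open>(a, b)\<close> applied to
  \<open>(s, t)\<close>, spelled out by the product rule so that linearity in \<open>(s, t)\<close>
  is pure algebra.\<close>

definition Phi_deriv :: "(real \<Rightarrow> real) \<Rightarrow> real \<Rightarrow> real \<Rightarrow> real \<Rightarrow> real \<Rightarrow> real" where
  "Phi_deriv \<phi> a b s t =
     (deriv (deriv \<phi>) b * t - deriv (deriv \<phi>) a * s) * (b - a) + (deriv \<phi> b - deriv \<phi> a) * (t - s)"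

lemma Phi_sym: "Phi \<phi> a b = Phi \<phi> b a"
  by (simp add: Phi_def algebra_simps)

lemma Phi_diag [simp]: "Phi \<phi> a a = 0"
  by (simp add: Phi_def)

lemma Phi_deriv_swap: "Phi_deriv \<phi> a b s t = Phi_deriv \<phi> b a t s"
  by (simp add: Phi_deriv_def algebra_simps)

lemma Phi_deriv_add:
  "Phi_deriv \<phi> a b (s + s') (t + t') = Phi_deriv \<phi> a b s t + Phi_deriv \<phi> a b s' t'"
  by (simp add: Phi_deriv_def algebra_simps)

lemma Phi_deriv_split: "Phi_deriv \<phi> a b s t = Phi_deriv \<phi> a b s 0 + Phi_deriv \<phi> a b 0 t"
  using Phi_deriv_add[of \<phi> a b s 0 0 t] by simp

lemma Phi_deriv_sum:
  "Phi_deriv \<phi> a b (\<Sum>y\<in>Y. s y) (\<Sum>y\<in>Y. t y) = (\<Sum>y\<in>Y. Phi_deriv \<phi> a b (s y) (t y))"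
proof -
  have 0: "Phi_deriv \<phi> a b 0 0 = 0"
    by (simp add: Phi_deriv_def)
  show ?thesis
    by (induction Y rule: infinite_finite_induct) (simp_all add: 0 Phi_deriv_add)
qed

lemma Phi_has_derivative:
  assumes "deriv \<phi> differentiable at (a + h * s)" "deriv \<phi> differentiable at (b + h * t)"
  shows "((\<lambda>h. Phi \<phi> (a + h * s) (b + h * t)) has_real_derivative
    Phi_deriv \<phi> (a + h * s) (b + h * t) s t) (at h)"
proof -
  have "((\<lambda>h. deriv \<phi> (a + h * s)) has_real_derivative deriv (deriv \<phi>) (a + h * s) * s) (at h)"
    using assms(1) by (intro DERIV_chain2[where f = "deriv \<phi>"])
      (auto simp: DERIV_deriv_iff_real_differentiable intro!: derivative_eq_intros)
  moreover have "((\<lambda>h. deriv \<phi> (b + h * t)) has_real_derivative deriv (deriv \<phi>) (b + h * t) * t) (at h)"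
    using assms(2) by (intro DERIV_chain2[where f = "deriv \<phi>"])
      (auto simp: DERIV_deriv_iff_real_differentiable intro!: derivative_eq_intros)
  ultimately show ?thesis
    unfolding Phi_def Phi_deriv_def
    by (auto intro!: derivative_eq_intros simp: algebra_simps)
qed

text \<open>\<open>l\<close> quantifies the decrease of \<open>\<Phi>(a, b)\<close> when one argument moves to the other, and \<open>u\<close> the
  additional decrease when both arguments move to each other; \<open>l = 1\<close>, \<open>u = 0\<close> is what the convexity of
  \<open>\<Phi>\<close> alone gives.\<close>

locale Phi_bounds =
  fixes \<phi> :: "real \<Rightarrow> real" and l u :: real
  assumes l_ge_1: "1 \<le> l" and u_nonneg: "0 \<le> u"
    and differentiable: "0 < a \<Longrightarrow> \<phi> differentiable at a"
    and deriv_differentiable: "0 < a \<Longrightarrow> deriv \<phi> differentiable at a"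
    and tangent: "0 < a \<Longrightarrow> 0 < b \<Longrightarrow> \<phi> a + deriv \<phi> a * (b - a) \<le> \<phi> b"
    and Phi_tangent: "0 < a \<Longrightarrow> 0 < b \<Longrightarrow> 0 < a' \<Longrightarrow> 0 < b' \<Longrightarrow>
      Phi_deriv \<phi> a b (a' - a) (b' - b) \<le> Phi \<phi> a' b' - Phi \<phi> a b"
    and Phi_merge: "0 < a \<Longrightarrow> 0 < b \<Longrightarrow> Phi_deriv \<phi> a b (b - a) 0 \<le> - l * Phi \<phi> a b"
    and Phi_swap: "0 < a \<Longrightarrow> 0 < b \<Longrightarrow>
      Phi_deriv \<phi> a b (b - a) (a - b) \<le> - (2 * l + 2 * u) * Phi \<phi> a b"
begin

lemma Phi_merge': "0 < a \<Longrightarrow> 0 < b \<Longrightarrow> Phi_deriv \<phi> a b 0 (a - b) \<le> - l * Phi \<phi> a b"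
  using Phi_merge[of b a] by (simp add: Phi_deriv_swap[of \<phi> b a] Phi_sym[of \<phi> b a])

lemma Phi_nonneg: "0 < a \<Longrightarrow> 0 < b \<Longrightarrow> 0 \<le> Phi \<phi> a b"
  using tangent[of a b] tangent[of b a] by (simp add: Phi_def algebra_simps)

lemma has_derivs:
  assumes "0 < a"
  shows "(\<phi> has_real_derivative deriv \<phi> a) (at a)"
    and "(deriv \<phi> has_real_derivative deriv (deriv \<phi>) a) (at a)"
  using differentiable[OF assms] deriv_differentiable[OF assms]
  by (simp_all add: DERIV_deriv_iff_real_differentiable)

lemma continuous_on_deriv: "continuous_on {0<..} (deriv \<phi>)"
  using has_derivs(2) by (intro DERIV_continuous_on) (auto intro: has_field_derivative_at_within)

lemma continuous_on_phi: "continuous_on {0<..} \<phi>"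
  using has_derivs(1) by (intro DERIV_continuous_on) (auto intro: has_field_derivative_at_within)

end


section \<open>General admissible functions\<close>

lemma has_derivative_le_chord:
  fixes g :: "real \<Rightarrow> real"
  assumes D: "(g has_real_derivative D) (at 0)"
    and le: "\<And>h. 0 < h \<Longrightarrow> h < 1 \<Longrightarrow> g h \<le> g 0 + h * d"
  shows "D \<le> d"
proof (rule ccontr)
  assume "\<not> D \<le> d"
  \<comment> \<open>With a positive derivative at \<open>0\<close>, \<open>g h - h * d\<close> would
    exceed \<open>g 0\<close> just to the right of \<open>0\<close>.\<close>
  moreover have "((\<lambda>h. g h - h * d) has_real_derivative D - d) (at 0)"
    by (auto intro!: derivative_eq_intros D)
  ultimately obtain \<epsilon> where "0 < \<epsilon>" and "\<And>h. 0 < h \<Longrightarrow> h < \<epsilon> \<Longrightarrow> g 0 < g h - h * d"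
    using DERIV_pos_inc_right[of "\<lambda>h. g h - h * d" "D - d" 0] by auto
  moreover define h where "h = min \<epsilon> 1 / 2"
  ultimately have "0 < h" "h < 1" "g 0 < g h - h * d" by auto
  with le[of h] show False by simp
qed

text \<open>The second derivative at \<open>a\<close> involves \<open>deriv \<phi>\<close> near
  \<open>a\<close>, so the explicit formulas are required on the whole open half-line.\<close>

lemma derivs_eqI:
  fixes \<phi> \<phi>' \<phi>'' :: "real \<Rightarrow> real"
  assumes "\<And>a. 0 < a \<Longrightarrow> (\<phi> has_real_derivative \<phi>' a) (at a)"
    and "\<And>a. 0 < a \<Longrightarrow> (\<phi>' has_real_derivative \<phi>'' a) (at a)" and a: "0 < a"
  shows "deriv \<phi> a = \<phi>' a" "deriv (deriv \<phi>) a = \<phi>'' a"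
    "\<phi> differentiable at a" "deriv \<phi> differentiable at a"
proof -
  have eq: "deriv \<phi> a = \<phi>' a" if "0 < a" for a
    using assms(1)[OF that] by (rule DERIV_imp_deriv)
  then show "deriv \<phi> a = \<phi>' a" using a .
  have "(deriv \<phi> has_real_derivative \<phi>'' a) (at a)"
    using assms(2)[OF a]
    by (rule has_field_derivative_transform_within_open[where S = "{0<..}"]) (use a eq in auto)
  then show "deriv (deriv \<phi>) a = \<phi>'' a" "deriv \<phi> differentiable at a"
    by (auto intro: DERIV_imp_deriv simp: real_differentiable_def)
  show "\<phi> differentiable at a"
    using assms(1)[OF a] by (auto simp: real_differentiable_def)
qed

text \<open>Chords of the convex \<open>Phi\<close> give its tangent inequality. Merging aims at the
  diagonal, where \<open>Phi\<close> vanishes, whence \<open>l = 1\<close>; a swap is a sum of two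
  merges by linearity, whence \<open>u = 0\<close>.\<close>

lemma Phi_bounds_admissible:
  assumes "admissible \<phi>"
  shows "Phi_bounds \<phi> 1 0"
proof -
  note adm = assms[unfolded admissible_def]
  have diff: "\<phi> differentiable at a" "deriv \<phi> differentiable at a" if "0 < a" for a
    using adm that by auto
  have Phi_tangent: "Phi_deriv \<phi> a b (a' - a) (b' - b) \<le> Phi \<phi> a' b' - Phi \<phi> a b"
    if pos: "0 < a" "0 < b" "0 < a'" "0 < b'" for a b a' b'
  proof (rule has_derivative_le_chord)
    show "((\<lambda>h. Phi \<phi> (a + h * (a' - a)) (b + h * (b' - b))) has_real_derivative
        Phi_deriv \<phi> a b (a' - a) (b' - b)) (at 0)"
      using Phi_has_derivative[of \<phi> a 0 "a' - a" b "b' - b"] diff(2) pos by simp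
    fix h :: real assume h: "0 < h" "h < 1"
    have "(\<lambda>(a, b). Phi \<phi> a b) ((1 - h) *\<^sub>R (a, b) + h *\<^sub>R (a', b'))
        \<le> (1 - h) * (\<lambda>(a, b). Phi \<phi> a b) (a, b) + h * (\<lambda>(a, b). Phi \<phi> a b) (a', b')"
      using adm h pos by (intro convex_onD[where A = "{0<..} \<times> {0<..}"]) auto
    then show "Phi \<phi> (a + h * (a' - a)) (b + h * (b' - b)) \<le>
        Phi \<phi> (a + 0 * (a' - a)) (b + 0 * (b' - b)) + h * (Phi \<phi> a' b' - Phi \<phi> a b)"
      by (simp add: algebra_simps)
  qed
  have merge: "Phi_deriv \<phi> a b (b - a) 0 \<le> - Phi \<phi> a b" if "0 < a" "0 < b" for a b
    using Phi_tangent[of a b b b] that by simp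
  show ?thesis
  proof
    fix a b :: real assume ab: "0 < a" "0 < b"
    have "(\<phi> has_real_derivative deriv \<phi> a) (at a within {0..})"
      using diff(1)[OF ab(1)] by (auto simp: DERIV_deriv_iff_real_differentiable intro: has_field_derivative_at_within)
    then have "deriv \<phi> a * (b - a) \<le> \<phi> b - \<phi> a"
      using adm ab by (intro convex_on_imp_above_tangent[where A = "{0..}"]) auto
    then show "\<phi> a + deriv \<phi> a * (b - a) \<le> \<phi> b" by simp
    show "Phi_deriv \<phi> a b (b - a) (a - b) \<le> - (2 * 1 + 2 * 0) * Phi \<phi> a b"
      using merge[OF ab] merge[OF ab(2,1)] Phi_deriv_split[of \<phi> a b "b - a" "a - b"]
        Phi_deriv_swap[of \<phi> a b 0 "a - b"] Phi_sym[of \<phi> a b] by simp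
  qed (use diff merge Phi_tangent in auto)
qed

section \<open>The logarithmic entropy\<close>

lemma two_ln_le:
  fixes x :: real
  assumes "1 \<le> x"
  shows "2 * ln x \<le> x - 1 / x"
proof -
  let ?g = "\<lambda>x :: real. x - 1 / x - 2 * ln x"
  have "?g 1 \<le> ?g x"
  proof (rule DERIV_nonneg_imp_nondecreasing[OF assms])
    fix y :: real assume y: "1 \<le> y" "y \<le> x"
    have "(?g has_real_derivative (1 - 1 / y)\<^sup>2) (at y)"
      using y by (auto intro!: derivative_eq_intros simp: power2_eq_square field_simps)
    then show "\<exists>z. (?g has_real_derivative z) (at y) \<and> 0 \<le> z"
      by (meson zero_le_power2)
  qed
  then show ?thesis by simp
qed

text \<open>Both sides are symmetric in \<open>a\<close> and \<open>b\<close>, so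
  \<open>two_ln_le\<close> at \<open>b / a\<close> for \<open>a \<le> b\<close> suffices. This is
  the comparison of the logarithmic with the harmonic mean, and the source of \<open>u = 1\<close>
  for \<open>phi_log\<close>.\<close>

lemma ln_diff_le:
  fixes a b :: real
  assumes "0 < a" "0 < b"
  shows "2 * ((ln b - ln a) * (b - a)) \<le> (1 / a + 1 / b) * (b - a)\<^sup>2"
proof -
  have *: "2 * ((ln b - ln a) * (b - a)) \<le> (1 / a + 1 / b) * (b - a)\<^sup>2"
    if "0 < a" "a \<le> b" for a b :: real
  proof -
    have "2 * (ln b - ln a) \<le> b / a - a / b"
      using two_ln_le[of "b / a"] that by (simp add: ln_div)
    also have "\<dots> = (1 / a + 1 / b) * (b - a)"
      using that by (simp add: field_simps)
    finally have "2 * (ln b - ln a) * (b - a) \<le> (1 / a + 1 / b) * (b - a) * (b - a)"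
      using that by (intro mult_right_mono) auto
    then show ?thesis by (simp only: power2_eq_square mult.assoc)
  qed
  show ?thesis
  proof (cases "a \<le> b")
    case True
    with * assms show ?thesis by simp
  next
    case False
    with *[of b a] assms show ?thesis
      by (simp add: power2_commute[of b a] add.commute) (simp add: algebra_simps)
  qed
qed

lemma Phi_bounds_log: "Phi_bounds phi_log 1 1"
proof -
  have "(phi_log has_real_derivative ln a) (at a)" "(ln has_real_derivative 1 / a) (at a)"
    if "0 < a" for a
    unfolding phi_log_def using that by (auto intro!: derivative_eq_intros)
  note D = derivs_eqI[of phi_log ln "\<lambda>a. 1 / a", OF this]
  have Phi: "Phi phi_log a b = (ln b - ln a) * (b - a)" if "0 < a" "0 < b" for a b
    using that by (simp add: Phi_def D)
  have Phi_deriv: "Phi_deriv phi_log a b s t = (t / b - s / a) * (b - a) + (ln b - ln a) * (t - s)"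
    if "0 < a" "0 < b" for a b s t
    using that by (simp add: Phi_deriv_def D)
  have ln_le: "ln x \<le> x - 1" if "0 < x" for x :: real
    using ln_add_one_self_le_self2[of "x - 1"] that by simp
  have Phi_tangent: "Phi_deriv phi_log a b (a' - a) (b' - b) \<le> Phi phi_log a' b' - Phi phi_log a b"
    if pos: "0 < a" "0 < b" "0 < a'" "0 < b'" for a b a' b'
  proof -
    \<comment> \<open>The gap in the tangent inequality is exactly
      \<open>a' * (z - 1 - ln z) + b' * (1 / z - 1 + ln z)\<close>, and both brackets are
      nonnegative.\<close>
    define z where "z = (a * b') / (b * a')"
    have z: "0 < z" unfolding z_def using pos by simp
    have ln_z: "ln z = ln a + ln b' - ln b - ln a'"
      unfolding z_def using pos by (simp add: ln_div ln_mult)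
    have "a' * ln z \<le> a' * (z - 1)"
      using pos ln_le[OF z] by (intro mult_left_mono) auto
    moreover have "b' * - ln z \<le> b' * (1 / z - 1)"
      using pos ln_le[of "1 / z"] z by (intro mult_left_mono) (auto simp: ln_div)
    moreover have "a' * z = a * b' / b" "b' * (1 / z) = b * a' / a"
      unfolding z_def using pos by (simp_all add: field_simps)
    ultimately have "a' * ln z + b' * - ln z \<le> a * b' / b + b * a' / a - a' - b'"
      by (simp only: right_diff_distrib)
    moreover have "((b' - b) / b - (a' - a) / a) * (b - a) = b' + a' - a * b' / b - b * a' / a"
      using pos by (simp add: field_simps)
    ultimately show ?thesis
      unfolding Phi_deriv[OF pos(1,2)] Phi[OF pos(1,2)] Phi[OF pos(3,4)]
      by (simp add: ln_z algebra_simps)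
  qed
  show ?thesis
  proof
    fix a b :: real assume ab: "0 < a" "0 < b"
    have "b * ln (a / b) \<le> b * (a / b - 1)"
      using ab ln_le[of "a / b"] by (intro mult_left_mono) auto
    then show "phi_log a + deriv phi_log a * (b - a) \<le> phi_log b"
      using ab by (simp add: D phi_log_def ln_div algebra_simps)
    show "Phi_deriv phi_log a b (b - a) 0 \<le> - 1 * Phi phi_log a b"
      using Phi_tangent[of a b b b] ab by simp
    show "Phi_deriv phi_log a b (b - a) (a - b) \<le> - (2 * 1 + 2 * 1) * Phi phi_log a b"
    proof -
      \<comment> \<open>The second-derivative part of the swap is at most \<open>-2\<close> times
        \<open>Phi\<close> by \<open>ln_diff_le\<close>, and the first-derivative part is exactly
        \<open>-2\<close> times \<open>Phi\<close>.\<close>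
      have "((a - b) / b - (b - a) / a) * (b - a) = - ((1 / a + 1 / b) * (b - a)\<^sup>2)"
        using ab by (simp add: power2_eq_square field_simps)
      moreover have "(ln b - ln a) * ((a - b) - (b - a)) = - 2 * ((ln b - ln a) * (b - a))"
        by (simp add: algebra_simps)
      moreover have "x + y \<le> - (2 * 1 + 2 * 1) * z" if "x = - w" "y = - 2 * z" "2 * z \<le> w"
        for w x y z :: real
        using that by simp
      ultimately show ?thesis
        using ln_diff_le[OF ab] unfolding Phi[OF ab] Phi_deriv[OF ab] by blast
    qed
  qed (use D Phi_tangent in auto)
qed

section \<open>The power entropies\<close>

lemma powr_le_affine:
  fixes x \<delta> :: real
  assumes "0 < x" "0 \<le> \<delta>" "\<delta> \<le> 1"
  shows "x powr \<delta> \<le> 1 + \<delta> * (x - 1)"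
  using Youngs_inequality_0[of \<delta> "1 - \<delta>" x 1] assms by (simp add: algebra_simps)

lemma quadratic_form_nonneg:
  fixes A B C s t :: real
  assumes "0 < A" "C\<^sup>2 \<le> A * B"
  shows "0 \<le> A * s\<^sup>2 + B * t\<^sup>2 - 2 * C * s * t"
proof -
  have "A * (A * s\<^sup>2 + B * t\<^sup>2 - 2 * C * s * t) = (A * s - C * t)\<^sup>2 + (A * B - C\<^sup>2) * t\<^sup>2"
    by (simp add: power2_eq_square algebra_simps)
  also have "0 \<le> \<dots>"
    using assms by simp
  finally show ?thesis
    using assms(1) by (simp add: zero_le_mult_iff)
qed

text \<open>For \<delta> = 2 - \<alpha> this is nonnegativity of the Hessian determinant of
  \<open>Phi (phi_power \<alpha>)\<close> up to a positive factor. Divided by \<open>P * Q\<close>,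
  both sides depend on \<open>x / y\<close> only: concavity of the power bounds the left by
  \<open>4 + \<delta> * (S - 2)\<close>, and the right is
  \<open>4 + \<delta> * (2 - \<delta>) * (S - 2)\<close>.\<close>

lemma power_hessian_discriminant:
  fixes x y \<delta> :: real
  assumes "0 < x" "0 < y" "0 \<le> \<delta>" "\<delta> \<le> 1"
  shows "(x powr - \<delta> + y powr - \<delta>)\<^sup>2 \<le>
    (x powr - \<delta> * (2 + \<delta> * (y / x - 1))) * (y powr - \<delta> * (2 + \<delta> * (x / y - 1)))"
proof -
  define P where "P = x powr - \<delta>"
  define Q where "Q = y powr - \<delta>"
  define S where "S = x / y + y / x"
  have PQ: "0 < P" "0 < Q" using assms by (simp_all add: P_def Q_def)
  have "P / Q = (y / x) powr \<delta>" "Q / P = (x / y) powr \<delta>"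
    using assms by (simp_all add: P_def Q_def powr_divide powr_minus field_simps)
  then have 1: "P / Q + Q / P \<le> 2 + \<delta> * (S - 2)"
    using powr_le_affine[of "y / x" \<delta>] powr_le_affine[of "x / y" \<delta>] assms
    by (simp add: S_def algebra_simps)
  have "S - 2 = (x - y)\<^sup>2 / (x * y)"
    using assms by (simp add: S_def power2_eq_square field_simps)
  then have S: "0 \<le> S - 2" using assms by simp
  have "\<delta> * (S - 2) \<le> (2 - \<delta>) * (\<delta> * (S - 2))"
    using assms S mult_right_mono[of 1 "2 - \<delta>" "\<delta> * (S - 2)"] by simp
  with 1 have 2: "P / Q + Q / P + 2 \<le> 4 + \<delta> * (2 - \<delta>) * (S - 2)"
    by (simp add: mult_ac)
  have "(P + Q)\<^sup>2 = (P * Q) * (P / Q + Q / P + 2)"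
    using PQ by (simp add: power2_eq_square field_simps)
  also have "\<dots> \<le> (P * Q) * (4 + \<delta> * (2 - \<delta>) * (S - 2))"
    using PQ 2 by (intro mult_left_mono) auto
  also have "4 + \<delta> * (2 - \<delta>) * (S - 2) = (2 + \<delta> * (y / x - 1)) * (2 + \<delta> * (x / y - 1))"
    using assms by (simp add: S_def field_simps)
  finally show ?thesis
    by (simp add: P_def Q_def mult_ac)
qed

lemma Phi_bounds_power:
  assumes \<alpha>: "1 < \<alpha>" "\<alpha> \<le> 2"
  shows "Phi_bounds (phi_power \<alpha>) \<alpha> 0"
proof -
  let ?\<phi> = "phi_power \<alpha>"
  let ?\<phi>1 = "\<lambda>a. 1 / (\<alpha> - 1) * (\<alpha> * a powr (\<alpha> - 1) - 1) - 1"
  let ?\<phi>2 = "\<lambda>a. \<alpha> * a powr (\<alpha> - 2)"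
  let ?\<phi>3 = "\<lambda>a. \<alpha> * ((\<alpha> - 2) * a powr (\<alpha> - 3))"
  have D1: "(?\<phi> has_real_derivative ?\<phi>1 a) (at a)" if "0 < a" for a
    unfolding phi_power_def
    by (rule derivative_eq_intros refl has_real_derivative_powr that | simp)+
  have D2: "(?\<phi>1 has_real_derivative ?\<phi>2 a) (at a)" if "0 < a" for a
    by (rule derivative_eq_intros refl has_real_derivative_powr that | use \<alpha> in simp)+
  have D3: "(?\<phi>2 has_real_derivative ?\<phi>3 a) (at a)" if "0 < a" for a
    by (rule derivative_eq_intros refl has_real_derivative_powr that | simp)+
  note D = derivs_eqI[of ?\<phi> ?\<phi>1 ?\<phi>2, OF D1 D2]
  define k where "k = \<alpha> / (\<alpha> - 1)"
  have k: "0 < k" "\<alpha> = k * (\<alpha> - 1)" unfolding k_def using \<alpha> by simp_all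
  have Phi: "Phi ?\<phi> a b = k * ((b powr (\<alpha> - 1) - a powr (\<alpha> - 1)) * (b - a))" if "0 < a" "0 < b" for a b
  proof -
    have "?\<phi>1 b - ?\<phi>1 a = k * (b powr (\<alpha> - 1) - a powr (\<alpha> - 1))"
      by (simp add: k_def diff_divide_distrib right_diff_distrib)
    then show ?thesis using that by (simp only: Phi_def D mult.assoc)
  qed
  have Phi_deriv: "Phi_deriv ?\<phi> a b s t =
      (?\<phi>2 b * t - ?\<phi>2 a * s) * (b - a) + (?\<phi>1 b - ?\<phi>1 a) * (t - s)" if "0 < a" "0 < b" for a b s t
    using that by (simp only: Phi_deriv_def D)
  \<comment> \<open>The first-derivative part is \<open>- Phi\<close>. The second-derivative part is
    at most \<open>- (\<alpha> - 1) * Phi\<close>, because \<open>z powr (\<alpha> - 2)\<close> is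
    nonincreasing in \<open>z\<close>.\<close>
  have merge: "Phi_deriv ?\<phi> a b (b - a) 0 \<le> - \<alpha> * Phi ?\<phi> a b" if ab: "0 < a" "0 < b" for a b
  proof -
    have pw: "x powr (\<alpha> - 1) = x powr (\<alpha> - 2) * x" if "0 < x" for x
      using that powr_add[of x "\<alpha> - 2" 1] by simp
    have "0 \<le> b * ((a powr (\<alpha> - 2) - b powr (\<alpha> - 2)) * (b - a))"
    proof (cases "a \<le> b")
      case True
      then have "b powr (\<alpha> - 2) \<le> a powr (\<alpha> - 2)" using ab \<alpha> by (intro powr_mono2') auto
      with True ab show ?thesis by simp
    next
      case False
      then have "a powr (\<alpha> - 2) \<le> b powr (\<alpha> - 2)" using ab \<alpha> by (intro powr_mono2') auto
      with False ab show ?thesis by (intro mult_nonneg_nonneg mult_nonpos_nonpos) auto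
    qed
    then have "(b powr (\<alpha> - 1) - a powr (\<alpha> - 1)) * (b - a) \<le> a powr (\<alpha> - 2) * (b - a)\<^sup>2"
      unfolding pw[OF ab(1)] pw[OF ab(2)] by (simp add: power2_eq_square algebra_simps)
    then have "\<alpha> * ((b powr (\<alpha> - 1) - a powr (\<alpha> - 1)) * (b - a)) \<le> \<alpha> * (a powr (\<alpha> - 2) * (b - a)\<^sup>2)"
      using \<alpha> by (intro mult_left_mono) auto
    moreover have "Phi_deriv ?\<phi> a b (b - a) 0 = - \<alpha> * (a powr (\<alpha> - 2) * (b - a)\<^sup>2) - Phi ?\<phi> a b"
    proof -
      have "Phi_deriv ?\<phi> a b (b - a) 0 = - (deriv (deriv ?\<phi>) a * (b - a)\<^sup>2) - Phi ?\<phi> a b"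
        by (simp add: Phi_deriv_def Phi_def power2_eq_square algebra_simps)
      then show ?thesis by (simp add: D ab)
    qed
    moreover have "\<alpha> * Phi ?\<phi> a b = \<alpha> * ((b powr (\<alpha> - 1) - a powr (\<alpha> - 1)) * (b - a)) + Phi ?\<phi> a b"
    proof -
      have "(\<alpha> - 1) * Phi ?\<phi> a b = (k * (\<alpha> - 1)) * ((b powr (\<alpha> - 1) - a powr (\<alpha> - 1)) * (b - a))"
        by (simp add: Phi[OF ab])
      then show ?thesis unfolding k(2)[symmetric] by (simp add: algebra_simps)
    qed
    ultimately show ?thesis by simp
  qed
  have Phi_tangent: "Phi_deriv ?\<phi> a b (a' - a) (b' - b) \<le> Phi ?\<phi> a' b' - Phi ?\<phi> a b"
    if pos: "0 < a" "0 < b" "0 < a'" "0 < b'" for a b a' b'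
  proof -
    define s where "s = a' - a"
    define t where "t = b' - b"
    let ?x = "\<lambda>h. a + h * s" and ?y = "\<lambda>h. b + h * t"
    \<comment> \<open>The Hessian of \<open>Phi\<close> in the direction \<open>(s, t)\<close>; its
      nonnegativity along the segment yields the tangent inequality.\<close>
    let ?g'' = "\<lambda>h. (?\<phi>3 (?y h) * t\<^sup>2 - ?\<phi>3 (?x h) * s\<^sup>2) * (?y h - ?x h)
      + 2 * ((?\<phi>2 (?y h) * t - ?\<phi>2 (?x h) * s) * (t - s))"
    have segment: "0 < p + h * (q - p)" if "h \<in> {0..1}" "0 < p" "0 < q" for h p q :: real
    proof -
      have "p + h * (q - p) = (1 - h) * p + h * q" by (simp add: algebra_simps)
      also have "\<dots> > 0" using that by (cases "h = 0") (auto intro!: add_nonneg_pos)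
      finally show ?thesis .
    qed
    have "Phi_deriv ?\<phi> (?x 0) (?y 0) s t * (1 - 0) \<le> Phi ?\<phi> (?x 1) (?y 1) - Phi ?\<phi> (?x 0) (?y 0)"
    proof (rule f''_imp_f'[where C = "{0..1}" and f = "\<lambda>h. Phi ?\<phi> (?x h) (?y h)"
          and f' = "\<lambda>h. Phi_deriv ?\<phi> (?x h) (?y h) s t" and f'' = ?g''])
      fix h :: real assume "h \<in> {0..1}"
      then have xy: "0 < ?x h" "0 < ?y h" using segment pos by (simp_all add: s_def t_def)
      show "((\<lambda>h. Phi ?\<phi> (?x h) (?y h)) has_real_derivative Phi_deriv ?\<phi> (?x h) (?y h) s t) (at h)"
        by (intro Phi_has_derivative D xy)
      have chain: "((\<lambda>h. f (p + h * q)) has_real_derivative f' (p + h * q) * q) (at h)"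
        if "(f has_real_derivative f' (p + h * q)) (at (p + h * q))" for f f' p q
        using that by (intro DERIV_chain2[where f = f]) (auto intro!: derivative_eq_intros)
      have dx: "(?x has_real_derivative s) (at h)" and dy: "(?y has_real_derivative t) (at h)"
        by (auto intro!: derivative_eq_intros)
      have "((\<lambda>h. (?\<phi>2 (?y h) * t - ?\<phi>2 (?x h) * s) * (?y h - ?x h) + (?\<phi>1 (?y h) - ?\<phi>1 (?x h)) * (t - s))
          has_real_derivative
          (?\<phi>3 (?y h) * t * t - ?\<phi>3 (?x h) * s * s) * (?y h - ?x h)
          + (t - s) * (?\<phi>2 (?y h) * t - ?\<phi>2 (?x h) * s)
          + (?\<phi>2 (?y h) * t - ?\<phi>2 (?x h) * s) * (t - s)) (at h)"
        by (intro DERIV_add DERIV_mult DERIV_diff DERIV_cmult_right chain[of ?\<phi>2 ?\<phi>3] chain[of ?\<phi>1 ?\<phi>2]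
            D2 D3 dx dy xy)
      then have "((\<lambda>h. (?\<phi>2 (?y h) * t - ?\<phi>2 (?x h) * s) * (?y h - ?x h) + (?\<phi>1 (?y h) - ?\<phi>1 (?x h)) * (t - s))
          has_real_derivative ?g'' h) (at h)"
        by (rule DERIV_cong) (simp add: power2_eq_square mult_ac)
      \<comment> \<open>The explicit formula represents \<open>Phi_deriv\<close> only at positive
        arguments; positivity persists near \<open>h\<close>, which suffices for the derivative
        there.\<close>
      moreover have "\<forall>\<^sub>F h' in nhds h. 0 < ?x h'" "\<forall>\<^sub>F h' in nhds h. 0 < ?y h'"
        using xy by (auto intro!: order_tendstoD(1) tendsto_eq_intros filterlim_ident)
      then have "\<forall>\<^sub>F h' in nhds h. (?\<phi>2 (?y h') * t - ?\<phi>2 (?x h') * s) * (?y h' - ?x h')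
          + (?\<phi>1 (?y h') - ?\<phi>1 (?x h')) * (t - s) = Phi_deriv ?\<phi> (?x h') (?y h') s t"
        by eventually_elim (simp only: Phi_deriv)
      ultimately show "((\<lambda>h. Phi_deriv ?\<phi> (?x h) (?y h) s t) has_real_derivative ?g'' h) (at h)"
        by (rule iffD1[OF DERIV_cong_ev[OF refl _ refl], rotated])
      define X where "X = ?x h"
      define Y where "Y = ?y h"
      have XY: "0 < X" "0 < Y" using xy by (simp_all add: X_def Y_def)
      \<comment> \<open>In terms of \<delta> the Hessian is \<alpha> times a quadratic form in
        \<open>s\<close> and \<open>t\<close>, to which the discriminant estimate applies.\<close>
      define \<delta> where "\<delta> = 2 - \<alpha>"
      have \<delta>: "0 \<le> \<delta>" "\<delta> \<le> 1" using \<alpha> by (simp_all add: \<delta>_def)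
      define P where "P = X powr - \<delta>"
      define Q where "Q = Y powr - \<delta>"
      have PQ: "0 < P" "0 < Q" using XY by (simp_all add: P_def Q_def)
      have pw: "z powr (\<alpha> - 3) = z powr - \<delta> / z" "z powr (\<alpha> - 2) = z powr - \<delta>" if "0 < z" for z
        using that powr_add[of z "- \<delta>" "- 1"] by (simp_all add: \<delta>_def powr_minus_divide)
      have "?g'' h = \<alpha> * ((P * (2 + \<delta> * (Y / X - 1))) * s\<^sup>2 + (Q * (2 + \<delta> * (X / Y - 1))) * t\<^sup>2
          - 2 * (P + Q) * s * t)"
        unfolding X_def[symmetric] Y_def[symmetric] pw[OF XY(1)] pw[OF XY(2)] P_def[symmetric] Q_def[symmetric]
        using XY by (simp add: \<delta>_def power2_eq_square field_simps)
      also have "\<dots> \<ge> 0"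
      proof (intro mult_nonneg_nonneg quadratic_form_nonneg)
        have "0 < 2 + \<delta> * (Y / X - 1)"
        proof -
          have "0 \<le> \<delta> * (Y / X)" using \<delta> XY by simp
          then show ?thesis using \<delta> by (simp only: right_diff_distrib)
        qed
        then show "0 < P * (2 + \<delta> * (Y / X - 1))" using PQ by simp
        show "(P + Q)\<^sup>2 \<le> P * (2 + \<delta> * (Y / X - 1)) * (Q * (2 + \<delta> * (X / Y - 1)))"
          unfolding P_def Q_def by (rule power_hessian_discriminant[OF XY \<delta>])
      qed (use \<alpha> in simp)
      finally show "0 \<le> ?g'' h" .
    qed auto
    then show ?thesis by (simp add: s_def t_def)
  qed
  show ?thesis
  proof
    fix a b :: real assume ab: "0 < a" "0 < b"
    have "?\<phi>1 a * (b - a) \<le> ?\<phi> b - ?\<phi> a"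
      by (rule f''_imp_f'[where C = "{0<..}" and f'' = ?\<phi>2]) (use D1 D2 ab \<alpha> in auto)
    then show "?\<phi> a + deriv ?\<phi> a * (b - a) \<le> ?\<phi> b" using D(1)[of a] ab by simp
    show "Phi_deriv ?\<phi> a b (b - a) (a - b) \<le> - (2 * \<alpha> + 2 * 0) * Phi ?\<phi> a b"
      using merge[OF ab] merge[OF ab(2,1)] Phi_deriv_split[of ?\<phi> a b "b - a" "a - b"]
        Phi_deriv_swap[of ?\<phi> a b 0 "a - b"] Phi_sym[of ?\<phi> a b] by simp
  qed (use D merge Phi_tangent \<alpha> in auto)
qed

section \<open>The coupling\<close>

text \<open>\<open>cycle\<close> says that the product of the rates from \<open>\<eta>\<close> to the opposite corner of a square does not depend
  on the path; it holds because \<open>c(\<eta>, \<sigma>)\<close> is the quotient of the values of \<open>exp (-\<beta>H/2)\<close> at \<open>\<sigma>\<eta>\<close> and \<open>\<eta>\<close>.\<close>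

locale flip_dynamics =
  fixes \<Omega> :: "'s set" and X :: "'x set" and act :: "'x \<Rightarrow> 's \<Rightarrow> 's"
    and c :: "'s \<Rightarrow> 'x \<Rightarrow> real" and m :: "'s \<Rightarrow> real" and r K :: real
  assumes finite_\<Omega>: "finite \<Omega>" and finite_X: "finite X"
    and act_in: "\<eta> \<in> \<Omega> \<Longrightarrow> x \<in> X \<Longrightarrow> act x \<eta> \<in> \<Omega>"
    and act_act: "act x (act x \<eta>) = \<eta>"
    and act_commute: "act x (act y \<eta>) = act y (act x \<eta>)"
    and c_pos: "0 < c \<eta> x" and m_pos: "0 < m \<eta>" and m_sum: "sum m \<Omega> = 1"
    and reversible: "x \<in> X \<Longrightarrow> m \<eta> * c \<eta> x = m (act x \<eta>) * c (act x \<eta>) x"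
    and cycle: "x \<in> X \<Longrightarrow> y \<in> X \<Longrightarrow> c \<eta> y * c (act y \<eta>) x = c \<eta> x * c (act x \<eta>) y"
    and irreducible: "(\<And>\<eta> x. \<eta> \<in> \<Omega> \<Longrightarrow> x \<in> X \<Longrightarrow> g (act x \<eta>) = g \<eta>) \<Longrightarrow>
      \<eta> \<in> \<Omega> \<Longrightarrow> \<eta>' \<in> \<Omega> \<Longrightarrow> g \<eta> = (g \<eta>' :: real)"
    and rate_ge: "\<eta> \<in> \<Omega> \<Longrightarrow> x \<in> X \<Longrightarrow> r \<le> c \<eta> x"
    and rate_sum: "\<eta> \<in> \<Omega> \<Longrightarrow> x \<in> X \<Longrightarrow> 2 \<le> c \<eta> x + c (act x \<eta>) x"
    and variation: "\<eta> \<in> \<Omega> \<Longrightarrow> x \<in> X \<Longrightarrow> (\<Sum>y\<in>X - {x}. \<bar>c \<eta> y - c (act x \<eta>) y\<bar>) \<le> K"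
    and K_le: "K \<le> r"
begin

definition gen :: "('s \<Rightarrow> real) \<Rightarrow> 's \<Rightarrow> real" where
  "gen f \<eta> = (\<Sum>x\<in>X. c \<eta> x * (f (act x \<eta>) - f \<eta>))"

definition fisher :: "(real \<Rightarrow> real) \<Rightarrow> ('s \<Rightarrow> real) \<Rightarrow> real" where
  "fisher \<phi> f = 1 / 2 * (\<Sum>\<eta>\<in>\<Omega>. \<Sum>x\<in>X. m \<eta> * c \<eta> x * Phi \<phi> (f \<eta>) (f (act x \<eta>)))"

section \<open>Reversible sums over squares formed by two flips\<close>

lemma sum_act: "x \<in> X \<Longrightarrow> (\<Sum>\<eta>\<in>\<Omega>. g (act x \<eta>)) = (\<Sum>\<eta>\<in>\<Omega>. g \<eta>)"
  by (rule sum.reindex_bij_witness[of _ "act x" "act x"]) (auto simp: act_in act_act)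

lemma corner_swap:
  assumes "x \<in> X" "y \<in> X"
  shows "m \<eta> * c \<eta> x * c (act x \<eta>) y = m \<eta> * c \<eta> y * c (act y \<eta>) x"
  using cycle[OF assms, of \<eta>] by simp

text \<open>By \<open>corner_swap\<close>, the path from \<open>act y \<eta>\<close> to
  \<open>act x \<eta>\<close> may be rerouted through \<open>\<eta>\<close>; reversibility then
  turns its first edge around.\<close>

lemma corner_shift:
  assumes "x \<in> X" "y \<in> X"
  shows "m (act y \<eta>) * c (act y \<eta>) x * c (act y (act x \<eta>)) y = m \<eta> * c \<eta> x * c \<eta> y"
proof -
  have "m (act y \<eta>) * c (act y \<eta>) x * c (act x (act y \<eta>)) y =
      m (act y \<eta>) * c (act y \<eta>) y * c (act y (act y \<eta>)) x"
    using assms by (rule corner_swap)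
  also have "\<dots> = m \<eta> * c \<eta> y * c \<eta> x"
    by (simp add: act_act reversible[OF assms(2), of \<eta>])
  finally show ?thesis by (simp add: act_commute mult_ac)
qed

lemma corner_shift':
  assumes "x \<in> X" "y \<in> X"
  shows "m (act y \<eta>) * c (act y \<eta>) x * c (act y \<eta>) y = m \<eta> * c \<eta> x * c (act x \<eta>) y"
  using corner_shift[OF assms, of "act y \<eta>"] by (simp add: act_act act_commute)

text \<open>Passing to \<open>act y \<eta>\<close> interchanges the two products under the minimum,
  by \<open>corner_shift\<close> and \<open>corner_shift'\<close>; the weight of the parallel moves
  is therefore invariant.\<close>

lemma min_shift:
  assumes "x \<in> X" "y \<in> X"
  shows "m (act y \<eta>) * c (act y \<eta>) x * min (c (act y \<eta>) y) (c (act x (act y \<eta>)) y) =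
    m \<eta> * c \<eta> x * min (c \<eta> y) (c (act x \<eta>) y)"
proof -
  have pos: "0 \<le> m \<zeta> * c \<zeta> x" for \<zeta>
    using c_pos m_pos by (simp add: less_imp_le)
  show ?thesis
    using corner_shift[OF assms, of \<eta>] corner_shift'[OF assms, of \<eta>] pos
    by (simp add: min_mult_distrib_left act_commute[of x y] min.commute)
qed

text \<open>Substituting \<open>act y \<eta>\<close> for \<open>\<eta>\<close> preserves both the
  weight and the sum, and carries one \<open>Phi\<close> term into the other.\<close>

lemma parallel_sum:
  assumes "x \<in> X" "y \<in> X"
  shows "(\<Sum>\<eta>\<in>\<Omega>. m \<eta> * c \<eta> x * min (c \<eta> y) (c (act x \<eta>) y) *
    (Phi \<phi> (f (act y \<eta>)) (f (act y (act x \<eta>))) - Phi \<phi> (f \<eta>) (f (act x \<eta>)))) = 0"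
proof -
  let ?w = "\<lambda>\<eta>. m \<eta> * c \<eta> x * min (c \<eta> y) (c (act x \<eta>) y)"
  let ?g = "\<lambda>\<eta>. ?w \<eta> * Phi \<phi> (f \<eta>) (f (act x \<eta>))"
  have "(\<Sum>\<eta>\<in>\<Omega>. ?w \<eta> * Phi \<phi> (f (act y \<eta>)) (f (act y (act x \<eta>)))) = (\<Sum>\<eta>\<in>\<Omega>. ?g (act y \<eta>))"
    by (intro sum.cong refl) (simp add: min_shift[OF assms, unfolded act_commute[of x y]] act_commute[of x y])
  also have "\<dots> = (\<Sum>\<eta>\<in>\<Omega>. ?g \<eta>)"
    using assms(2) by (rule sum_act)
  finally show ?thesis
    by (simp add: right_diff_distrib sum_subtractf)
qed

text \<open>Trades the excess rate at \<open>y\<close> caused by a flip at \<open>x\<close> for the excess rate at \<open>x\<close> caused by a flip at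
  \<open>y\<close>, so that a single bound on the variation of the rates controls both.\<close>

lemma excess_swap:
  assumes "x \<in> X" "y \<in> X"
  shows "m \<eta> * c \<eta> x * max 0 (c \<eta> y - c (act x \<eta>) y) = m \<eta> * c \<eta> y * max 0 (c \<eta> x - c (act y \<eta>) x)"
proof -
  have *: "k * max 0 z = max 0 (k * z)" if "0 < k" for k z :: real
    using that by (simp add: max_mult_distrib_left)
  have pos: "0 < m \<eta> * c \<eta> z" for z
    using c_pos m_pos by simp
  show ?thesis
    by (simp only: *[OF pos] right_diff_distrib corner_swap[OF assms]) (simp add: mult_ac)
qed

text \<open>The trade \<open>excess_swap\<close> turns the first term into the part where
  \<open>c \<eta> x\<close> exceeds \<open>c (act y \<eta>) x\<close>. The second term gives the
  same sum after reflection in \<open>x\<close>; a further reflection in \<open>y\<close> turns that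
  into the opposite part, and the two parts add up to the absolute value.\<close>

lemma excess_sum:
  assumes "x \<in> X" "y \<in> X"
  shows "(\<Sum>\<eta>\<in>\<Omega>. m \<eta> * c \<eta> x * (max 0 (c \<eta> y - c (act x \<eta>) y) * Phi \<phi> (f (act y \<eta>)) (f \<eta>)
      + max 0 (c (act x \<eta>) y - c \<eta> y) * Phi \<phi> (f (act x \<eta>)) (f (act y (act x \<eta>)))))
    = (\<Sum>\<eta>\<in>\<Omega>. m \<eta> * c \<eta> y * \<bar>c \<eta> x - c (act y \<eta>) x\<bar> * Phi \<phi> (f \<eta>) (f (act y \<eta>)))"
proof -
  let ?g = "\<lambda>\<eta>. m \<eta> * c \<eta> y * max 0 (c \<eta> x - c (act y \<eta>) x) * Phi \<phi> (f \<eta>) (f (act y \<eta>))"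
  let ?g' = "\<lambda>\<eta>. m \<eta> * c \<eta> y * max 0 (c (act y \<eta>) x - c \<eta> x) * Phi \<phi> (f \<eta>) (f (act y \<eta>))"
  have 1: "(\<Sum>\<eta>\<in>\<Omega>. m \<eta> * c \<eta> x * max 0 (c \<eta> y - c (act x \<eta>) y) * Phi \<phi> (f (act y \<eta>)) (f \<eta>)) =
      (\<Sum>\<eta>\<in>\<Omega>. ?g \<eta>)"
    by (simp only: excess_swap[OF assms] Phi_sym)
  have "(\<Sum>\<eta>\<in>\<Omega>. m \<eta> * c \<eta> x * max 0 (c (act x \<eta>) y - c \<eta> y) *
      Phi \<phi> (f (act x \<eta>)) (f (act y (act x \<eta>)))) = (\<Sum>\<eta>\<in>\<Omega>. ?g (act x \<eta>))"
    using excess_swap[OF assms, of "act x _"] reversible[OF assms(1)]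
    by (intro sum.cong refl) (simp add: act_act)
  also have "\<dots> = (\<Sum>\<eta>\<in>\<Omega>. ?g \<eta>)"
    using assms(1) by (rule sum_act)
  also have "\<dots> = (\<Sum>\<eta>\<in>\<Omega>. ?g (act y \<eta>))"
    using sum_act[OF assms(2), of ?g] by simp
  also have "\<dots> = (\<Sum>\<eta>\<in>\<Omega>. ?g' \<eta>)"
    using reversible[OF assms(2)] by (intro sum.cong refl) (simp add: act_act Phi_sym)
  finally have 2: "(\<Sum>\<eta>\<in>\<Omega>. m \<eta> * c \<eta> x * max 0 (c (act x \<eta>) y - c \<eta> y) *
      Phi \<phi> (f (act x \<eta>)) (f (act y (act x \<eta>)))) = (\<Sum>\<eta>\<in>\<Omega>. ?g' \<eta>)" .
  have abs: "\<bar>c \<eta> x - c (act y \<eta>) x\<bar> =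
      max 0 (c \<eta> x - c (act y \<eta>) x) + max 0 (c (act y \<eta>) x - c \<eta> x)" for \<eta>
    by auto
  show ?thesis
    unfolding abs distrib_left distrib_right sum.distrib 1[symmetric] 2[symmetric]
    by (simp add: mult.assoc)
qed

lemma gen_split:
  assumes "x \<in> X"
  shows "gen f \<eta> = c \<eta> x * (f (act x \<eta>) - f \<eta>) + (\<Sum>y\<in>X - {x}. c \<eta> y * (f (act y \<eta>) - f \<eta>))"
  unfolding gen_def using finite_X assms by (rule sum.remove)

text \<open>By reversibility each edge can be read from either end; averaging both readings produces
  a product of differences. For \<open>g = deriv \<phi>\<close> this yields the Fisher
  information.\<close>

lemma sum_by_parts:
  "(\<Sum>\<eta>\<in>\<Omega>. g (f \<eta>) * gen f \<eta> * m \<eta>) =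
    - (1 / 2) * (\<Sum>\<eta>\<in>\<Omega>. \<Sum>x\<in>X. m \<eta> * c \<eta> x * ((g (f (act x \<eta>)) - g (f \<eta>)) * (f (act x \<eta>) - f \<eta>)))"
proof -
  let ?S = "\<Sum>x\<in>X. \<Sum>\<eta>\<in>\<Omega>. m \<eta> * c \<eta> x * (g (f \<eta>) * (f (act x \<eta>) - f \<eta>))"
  have S: "(\<Sum>\<eta>\<in>\<Omega>. g (f \<eta>) * gen f \<eta> * m \<eta>) = ?S"
    unfolding gen_def by (subst sum.swap) (simp add: sum_distrib_left sum_distrib_right mult_ac)
  have "(\<Sum>\<eta>\<in>\<Omega>. m \<eta> * c \<eta> x * (g (f \<eta>) * (f (act x \<eta>) - f \<eta>))) =
      (\<Sum>\<eta>\<in>\<Omega>. m \<eta> * c \<eta> x * (g (f (act x \<eta>)) * (f \<eta> - f (act x \<eta>))))" if x: "x \<in> X" for x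
    using sum_act[OF x, of "\<lambda>\<eta>. m \<eta> * c \<eta> x * (g (f \<eta>) * (f (act x \<eta>) - f \<eta>))"] reversible[OF x]
    by (simp add: act_act)
  then have "?S = (\<Sum>x\<in>X. \<Sum>\<eta>\<in>\<Omega>. m \<eta> * c \<eta> x * (g (f (act x \<eta>)) * (f \<eta> - f (act x \<eta>))))"
    by (rule sum.cong[OF refl])
  then have "2 * ?S = - (\<Sum>x\<in>X. \<Sum>\<eta>\<in>\<Omega>. m \<eta> * c \<eta> x *
      ((g (f (act x \<eta>)) - g (f \<eta>)) * (f (act x \<eta>) - f \<eta>)))"
    by (simp add: algebra_simps sum.distrib sum_subtractf sum_negf)
  then show ?thesis
    by (subst sum.swap) (simp add: S)
qed

lemma sum_gen: "(\<Sum>\<eta>\<in>\<Omega>. gen f \<eta> * m \<eta>) = 0"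
  using sum_by_parts[of "\<lambda>_. 1" f] by simp

end

section \<open>Decay of the Fisher information\<close>

locale convex_flip_dynamics = flip_dynamics \<Omega> X act c m r K + Phi_bounds \<phi> l u
  for \<Omega> :: "'s set" and X :: "'x set" and act c m r K \<phi> l u
begin

lemma fisher_nonneg:
  assumes "\<And>\<eta>. \<eta> \<in> \<Omega> \<Longrightarrow> 0 < f \<eta>"
  shows "0 \<le> fisher \<phi> f"
  unfolding fisher_def using c_pos m_pos
  by (intro mult_nonneg_nonneg sum_nonneg) (auto intro!: Phi_nonneg assms act_in simp: less_imp_le)

text \<open>The common rate \<open>r - K\<close>, nonnegative by \<open>K_le\<close>, is split off
  from both merging rates and spent on a swap, which profits from \<open>u\<close>; the remainders
  are single merges.\<close>

lemma merge_bound: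
  assumes ab: "0 < a" "0 < b" and M: "r - K \<le> M" "r - K \<le> M'"
  shows "M * Phi_deriv \<phi> a b (b - a) 0 + M' * Phi_deriv \<phi> a b 0 (a - b)
    \<le> - (l * (M + M') + 2 * u * (r - K)) * Phi \<phi> a b"
proof -
  let ?P = "Phi \<phi> a b" and ?k = "r - K"
  have "(M - ?k) * Phi_deriv \<phi> a b (b - a) 0 \<le> (M - ?k) * (- l * ?P)"
    using M by (intro mult_left_mono Phi_merge ab) auto
  moreover have "(M' - ?k) * Phi_deriv \<phi> a b 0 (a - b) \<le> (M' - ?k) * (- l * ?P)"
    using M by (intro mult_left_mono Phi_merge' ab) auto
  moreover have "?k * (Phi_deriv \<phi> a b (b - a) 0 + Phi_deriv \<phi> a b 0 (a - b))
      \<le> ?k * (- (2 * l + 2 * u) * ?P)"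
    using K_le Phi_swap[OF ab] Phi_deriv_split[of \<phi> a b "b - a" "a - b"]
    by (intro mult_left_mono) auto
  moreover have "(M - ?k) * (- l * ?P) + (M' - ?k) * (- l * ?P) + ?k * (- (2 * l + 2 * u) * ?P) =
      - (l * (M + M') + 2 * u * ?k) * ?P"
    by (simp add: algebra_simps)
  moreover have "M * p + M' * q = (M - ?k) * p + (M' - ?k) * q + ?k * (p + q)" for p q
    by (simp add: algebra_simps)
  ultimately show ?thesis by (smt (verit))
qed

text \<open>The coupling: a flip at \<open>y \<noteq> x\<close> is performed in both copies \<open>\<eta>\<close> and \<open>act x \<eta>\<close> at the smaller of
  its two rates, and its excess rate in one copy is paired with the flip at \<open>x\<close> in the other, so that the
  two copies remain neighbours.  The remaining flips at \<open>x\<close> merge the copies.\<close>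

lemma coupling_bound:
  assumes f: "\<And>\<eta>. \<eta> \<in> \<Omega> \<Longrightarrow> 0 < f \<eta>" and \<eta>: "\<eta> \<in> \<Omega>" and x: "x \<in> X"
  shows "Phi_deriv \<phi> (f \<eta>) (f (act x \<eta>)) (gen f \<eta>) (gen f (act x \<eta>)) \<le>
    (\<Sum>y\<in>X - {x}.
        min (c \<eta> y) (c (act x \<eta>) y) *
          (Phi \<phi> (f (act y \<eta>)) (f (act y (act x \<eta>))) - Phi \<phi> (f \<eta>) (f (act x \<eta>)))
      + (max 0 (c \<eta> y - c (act x \<eta>) y) * Phi \<phi> (f (act y \<eta>)) (f \<eta>)
      + max 0 (c (act x \<eta>) y - c \<eta> y) * Phi \<phi> (f (act x \<eta>)) (f (act y (act x \<eta>)))))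
    - (2 * l - (l - 1) * K + 2 * u * (r - K)) * Phi \<phi> (f \<eta>) (f (act x \<eta>))"
proof -
  let ?a = "f \<eta>" and ?b = "f (act x \<eta>)"
  let ?T = "Phi_deriv \<phi> ?a ?b" and ?P = "Phi \<phi> ?a ?b"
  let ?s = "\<lambda>y. f (act y \<eta>)" and ?t = "\<lambda>y. f (act y (act x \<eta>))"
  define n where "n = (\<lambda>y. min (c \<eta> y) (c (act x \<eta>) y))"
  define e where "e = (\<lambda>y. max 0 (c \<eta> y - c (act x \<eta>) y))"
  define e' where "e' = (\<lambda>y. max 0 (c (act x \<eta>) y - c \<eta> y))"
  let ?Y = "X - {x}"
  define E where "E = (\<Sum>y\<in>?Y. e y)"
  define E' where "E' = (\<Sum>y\<in>?Y. e' y)"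
  note pos = f[OF \<eta>] f[OF act_in[OF \<eta> x]]
  have nonneg: "0 \<le> n y" "0 \<le> e y" "0 \<le> e' y" for y
    using c_pos[of \<eta> y] c_pos[of "act x \<eta>" y] by (auto simp: n_def e_def e'_def)
  have split: "c \<eta> y = n y + e y" "c (act x \<eta>) y = n y + e' y" for y
    by (auto simp: n_def e_def e'_def)
  have E_nonneg: "0 \<le> E" "0 \<le> E'"
    unfolding E_def E'_def by (auto intro: sum_nonneg nonneg)
  have "E + E' = (\<Sum>y\<in>?Y. \<bar>c \<eta> y - c (act x \<eta>) y\<bar>)"
    unfolding E_def E'_def sum.distrib[symmetric] by (intro sum.cong) (auto simp: e_def e'_def)
  then have E_le: "E + E' \<le> K"
    using variation[OF \<eta> x] by simp
  have term_le: "?T (c \<eta> y * (?s y - ?a)) (c (act x \<eta>) y * (?t y - ?b)) \<le>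
      n y * (Phi \<phi> (?s y) (?t y) - ?P) + (e y * Phi \<phi> (?s y) ?a + e' y * Phi \<phi> ?b (?t y))
      - (e y + e' y) * ?P - e y * ?T 0 (?a - ?b) - e' y * ?T (?b - ?a) 0"
    if "y \<in> ?Y" for y
  proof -
    have y: "y \<in> X" using that by simp
    have st: "0 < ?s y" "0 < ?t y" using f act_in \<eta> x y by auto
    \<comment> \<open>The excess of a flip at \<open>y\<close> in one copy is completed by a flip at
      \<open>x\<close> in the other. These borrowed flips at \<open>x\<close> are subtracted again
      and later charged to the merging rates.\<close>
    have lin: "?T ((k + j) * s) ((k + j') * t) = k * ?T s t + j * ?T s q + j' * ?T p t
        - j * ?T 0 q - j' * ?T p 0" for k j j' s t p q
      by (simp add: Phi_deriv_def algebra_simps)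
    have "?T (c \<eta> y * (?s y - ?a)) (c (act x \<eta>) y * (?t y - ?b)) =
        n y * ?T (?s y - ?a) (?t y - ?b) + e y * ?T (?s y - ?a) (?a - ?b)
        + e' y * ?T (?b - ?a) (?t y - ?b) - e y * ?T 0 (?a - ?b) - e' y * ?T (?b - ?a) 0"
      unfolding split by (rule lin)
    moreover have "n y * ?T (?s y - ?a) (?t y - ?b) \<le> n y * (Phi \<phi> (?s y) (?t y) - ?P)"
      by (intro mult_left_mono Phi_tangent pos st nonneg)
    moreover have "e y * ?T (?s y - ?a) (?a - ?b) \<le> e y * (Phi \<phi> (?s y) ?a - ?P)"
      by (intro mult_left_mono Phi_tangent pos st nonneg)
    moreover have "e' y * ?T (?b - ?a) (?t y - ?b) \<le> e' y * (Phi \<phi> ?b (?t y) - ?P)"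
      by (intro mult_left_mono Phi_tangent pos st nonneg)
    ultimately show ?thesis
      unfolding distrib_right right_diff_distrib by linarith
  qed
  let ?R = "\<Sum>y\<in>?Y. n y * (Phi \<phi> (?s y) (?t y) - ?P)
    + (e y * Phi \<phi> (?s y) ?a + e' y * Phi \<phi> ?b (?t y))"
  have "?T (gen f \<eta>) (gen f (act x \<eta>)) = ?T (c \<eta> x * (?b - ?a)) (c (act x \<eta>) x * (?a - ?b))
      + (\<Sum>y\<in>?Y. ?T (c \<eta> y * (?s y - ?a)) (c (act x \<eta>) y * (?t y - ?b)))"
    by (simp only: gen_split[OF x] act_act Phi_deriv_add Phi_deriv_sum)
  moreover have "?T (c \<eta> x * (?b - ?a)) (c (act x \<eta>) x * (?a - ?b)) =
      c \<eta> x * ?T (?b - ?a) 0 + c (act x \<eta>) x * ?T 0 (?a - ?b)"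
    by (simp add: Phi_deriv_def algebra_simps)
  moreover have "(\<Sum>y\<in>?Y. ?T (c \<eta> y * (?s y - ?a)) (c (act x \<eta>) y * (?t y - ?b))) \<le>
      (\<Sum>y\<in>?Y. n y * (Phi \<phi> (?s y) (?t y) - ?P) + (e y * Phi \<phi> (?s y) ?a + e' y * Phi \<phi> ?b (?t y))
      - (e y + e' y) * ?P - e y * ?T 0 (?a - ?b) - e' y * ?T (?b - ?a) 0)"
    by (rule sum_mono) (rule term_le)
  moreover have "(\<Sum>y\<in>?Y. n y * (Phi \<phi> (?s y) (?t y) - ?P) + (e y * Phi \<phi> (?s y) ?a + e' y * Phi \<phi> ?b (?t y))
      - (e y + e' y) * ?P - e y * ?T 0 (?a - ?b) - e' y * ?T (?b - ?a) 0) =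
      ?R - (E + E') * ?P - E * ?T 0 (?a - ?b) - E' * ?T (?b - ?a) 0"
    unfolding E_def E'_def
    by (simp only: sum_subtractf sum_distrib_right sum.distrib distrib_right)
  \<comment> \<open>After the borrowing each merging rate is still at least \<open>r - K\<close>,
    since \<open>E\<close> and \<open>E'\<close> are nonnegative with sum at most
    \<open>K\<close>.\<close>
  moreover have "(c \<eta> x - E') * ?T (?b - ?a) 0 + (c (act x \<eta>) x - E) * ?T 0 (?a - ?b)
      \<le> - (l * ((c \<eta> x - E') + (c (act x \<eta>) x - E)) + 2 * u * (r - K)) * ?P"
    using E_le E_nonneg rate_ge[OF \<eta> x] rate_ge[OF act_in[OF \<eta> x] x]
    by (intro merge_bound pos) auto
  \<comment> \<open>Borrowing costs \<open>l * (E + E')\<close> of merging, while the excess moves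
    themselves bring a loss term \<open>E + E'\<close>; the net cost is
    \<open>(l - 1) * (E + E')\<close>.\<close>
  moreover have "- (l * ((c \<eta> x - E') + (c (act x \<eta>) x - E)) + 2 * u * (r - K)) * ?P - (E + E') * ?P =
      - (l * (c \<eta> x + c (act x \<eta>) x) - (l - 1) * (E + E') + 2 * u * (r - K)) * ?P"
    by (simp add: algebra_simps)
  moreover have "(C - E') * p + (C' - E) * q = C * p + C' * q - E * q - E' * p" for C C' p q
    by (simp add: algebra_simps)
  ultimately have "?T (gen f \<eta>) (gen f (act x \<eta>)) \<le> ?R
      + - (l * (c \<eta> x + c (act x \<eta>) x) - (l - 1) * (E + E') + 2 * u * (r - K)) * ?P"
    by (smt (verit))
  then have "?T (gen f \<eta>) (gen f (act x \<eta>)) \<le> ?R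
      - (l * (c \<eta> x + c (act x \<eta>) x) - (l - 1) * (E + E') + 2 * u * (r - K)) * ?P"
    by (simp only: mult_minus_left add_uminus_conv_diff)
  moreover have "(2 * l - (l - 1) * K + 2 * u * (r - K)) * ?P \<le>
      (l * (c \<eta> x + c (act x \<eta>) x) - (l - 1) * (E + E') + 2 * u * (r - K)) * ?P"
  proof (intro mult_right_mono Phi_nonneg pos)
    have "l * 2 \<le> l * (c \<eta> x + c (act x \<eta>) x)"
      using l_ge_1 rate_sum[OF \<eta> x] by (intro mult_left_mono) auto
    moreover have "(l - 1) * (E + E') \<le> (l - 1) * K"
      using l_ge_1 E_le by (intro mult_left_mono) auto
    ultimately show "2 * l - (l - 1) * K + 2 * u * (r - K) \<le>
        l * (c \<eta> x + c (act x \<eta>) x) - (l - 1) * (E + E') + 2 * u * (r - K)" by simp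
  qed
  ultimately have "?T (gen f \<eta>) (gen f (act x \<eta>)) \<le> ?R
      - (2 * l - (l - 1) * K + 2 * u * (r - K)) * ?P"
    by linarith
  then show ?thesis unfolding n_def e_def e'_def .
qed

text \<open>The left side is the derivative of \<open>fisher\<close> along the generator. Parallel
  terms cancel, and the excess terms return \<open>K\<close> times \<open>fisher\<close>; together
  with the cost \<open>(l - 1) * K\<close> from the coupling this makes
  \<open>l * K\<close>.\<close>

lemma fisher_decay:
  assumes f: "\<And>\<eta>. \<eta> \<in> \<Omega> \<Longrightarrow> 0 < f \<eta>"
  shows "1 / 2 * (\<Sum>\<eta>\<in>\<Omega>. \<Sum>x\<in>X. m \<eta> * c \<eta> x *
      Phi_deriv \<phi> (f \<eta>) (f (act x \<eta>)) (gen f \<eta>) (gen f (act x \<eta>)))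
    \<le> - (l * (2 - K) + 2 * u * (r - K)) * fisher \<phi> f"
proof -
  let ?W = "\<lambda>\<eta> x. m \<eta> * c \<eta> x"
  let ?P = "\<lambda>\<eta> x. Phi \<phi> (f \<eta>) (f (act x \<eta>))"
  let ?k = "2 * l - (l - 1) * K + 2 * u * (r - K)"
  let ?A = "\<lambda>\<eta> x y. ?W \<eta> x * min (c \<eta> y) (c (act x \<eta>) y) *
    (Phi \<phi> (f (act y \<eta>)) (f (act y (act x \<eta>))) - ?P \<eta> x)"
  let ?B = "\<lambda>\<eta> x y. ?W \<eta> x * (max 0 (c \<eta> y - c (act x \<eta>) y) * Phi \<phi> (f (act y \<eta>)) (f \<eta>)
    + max 0 (c (act x \<eta>) y - c \<eta> y) * Phi \<phi> (f (act x \<eta>)) (f (act y (act x \<eta>))))"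
  have W: "0 \<le> ?W \<eta> x" for \<eta> x
    using c_pos m_pos by (simp add: less_imp_le)
  have "(\<Sum>\<eta>\<in>\<Omega>. \<Sum>x\<in>X. ?W \<eta> x * Phi_deriv \<phi> (f \<eta>) (f (act x \<eta>)) (gen f \<eta>) (gen f (act x \<eta>)))
      \<le> (\<Sum>\<eta>\<in>\<Omega>. \<Sum>x\<in>X. (\<Sum>y\<in>X - {x}. ?A \<eta> x y) + (\<Sum>y\<in>X - {x}. ?B \<eta> x y) - ?k * (?W \<eta> x * ?P \<eta> x))"
  proof (intro sum_mono)
    fix \<eta> x assume "\<eta> \<in> \<Omega>" "x \<in> X"
    have eq: "w * ((\<Sum>y\<in>Y. n y * p y + b y) - k * q) =
        (\<Sum>y\<in>Y. w * n y * p y) + (\<Sum>y\<in>Y. w * b y) - k * (w * q)"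
      for w k q :: real and n p b and Y :: "'x set"
      by (simp add: right_diff_distrib distrib_left sum.distrib sum_distrib_left mult_ac)
    from mult_left_mono[OF coupling_bound[OF f \<open>\<eta> \<in> \<Omega>\<close> \<open>x \<in> X\<close>] W[of \<eta> x]]
    show "?W \<eta> x * Phi_deriv \<phi> (f \<eta>) (f (act x \<eta>)) (gen f \<eta>) (gen f (act x \<eta>))
      \<le> (\<Sum>y\<in>X - {x}. ?A \<eta> x y) + (\<Sum>y\<in>X - {x}. ?B \<eta> x y) - ?k * (?W \<eta> x * ?P \<eta> x)"
      unfolding eq .
  qed
  also have "\<dots> = (\<Sum>\<eta>\<in>\<Omega>. \<Sum>x\<in>X. \<Sum>y\<in>X - {x}. ?A \<eta> x y) + (\<Sum>\<eta>\<in>\<Omega>. \<Sum>x\<in>X. \<Sum>y\<in>X - {x}. ?B \<eta> x y)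
      - 2 * ?k * fisher \<phi> f"
  proof -
    have "2 * ?k * fisher \<phi> f = (\<Sum>\<eta>\<in>\<Omega>. \<Sum>x\<in>X. ?k * (?W \<eta> x * ?P \<eta> x))"
      unfolding fisher_def sum_distrib_left[symmetric] by simp
    then show ?thesis by (simp only: sum.distrib sum_subtractf)
  qed
  finally have *: "(\<Sum>\<eta>\<in>\<Omega>. \<Sum>x\<in>X. ?W \<eta> x *
      Phi_deriv \<phi> (f \<eta>) (f (act x \<eta>)) (gen f \<eta>) (gen f (act x \<eta>))) \<le>
      (\<Sum>\<eta>\<in>\<Omega>. \<Sum>x\<in>X. \<Sum>y\<in>X - {x}. ?A \<eta> x y)
      + (\<Sum>\<eta>\<in>\<Omega>. \<Sum>x\<in>X. \<Sum>y\<in>X - {x}. ?B \<eta> x y) - 2 * ?k * fisher \<phi> f" .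
  have "(\<Sum>\<eta>\<in>\<Omega>. \<Sum>x\<in>X. \<Sum>y\<in>X - {x}. ?A \<eta> x y) = (\<Sum>x\<in>X. \<Sum>y\<in>X - {x}. \<Sum>\<eta>\<in>\<Omega>. ?A \<eta> x y)"
    by (subst sum.swap) (intro sum.cong refl sum.swap)
  also have "\<dots> = 0"
    by (intro sum.neutral ballI parallel_sum) auto
  finally have A: "(\<Sum>\<eta>\<in>\<Omega>. \<Sum>x\<in>X. \<Sum>y\<in>X - {x}. ?A \<eta> x y) = 0" .
  have "(\<Sum>\<eta>\<in>\<Omega>. \<Sum>x\<in>X. \<Sum>y\<in>X - {x}. ?B \<eta> x y) = (\<Sum>x\<in>X. \<Sum>y\<in>X - {x}. \<Sum>\<eta>\<in>\<Omega>. ?B \<eta> x y)"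
    by (subst sum.swap) (intro sum.cong refl sum.swap)
  also have "\<dots> = (\<Sum>x\<in>X. \<Sum>y\<in>X - {x}. \<Sum>\<eta>\<in>\<Omega>. ?W \<eta> y * \<bar>c \<eta> x - c (act y \<eta>) x\<bar> * ?P \<eta> y)"
    by (intro sum.cong refl excess_sum) auto
  \<comment> \<open>With \<open>y\<close> outermost, the inner sum over \<open>x\<close> is the
    total variation of the rates under one flip at \<open>y\<close>, which \<open>K\<close>
    bounds.\<close>
  also have "\<dots> = (\<Sum>y\<in>X. \<Sum>x\<in>X - {y}. \<Sum>\<eta>\<in>\<Omega>. ?W \<eta> y * \<bar>c \<eta> x - c (act y \<eta>) x\<bar> * ?P \<eta> y)"
    using finite_X by (simp add: sum.Sigma) (rule sum.reindex_bij_witness[of _ "\<lambda>(x, y). (y, x)" "\<lambda>(x, y). (y, x)"]; auto)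
  also have "\<dots> = (\<Sum>\<eta>\<in>\<Omega>. \<Sum>y\<in>X. \<Sum>x\<in>X - {y}. ?W \<eta> y * \<bar>c \<eta> x - c (act y \<eta>) x\<bar> * ?P \<eta> y)"
    by (subst sum.swap[of _ X \<Omega>]) (intro sum.cong refl sum.swap)
  also have "\<dots> \<le> (\<Sum>\<eta>\<in>\<Omega>. \<Sum>y\<in>X. K * (?W \<eta> y * ?P \<eta> y))"
  proof (intro sum_mono)
    fix \<eta> y assume \<eta>: "\<eta> \<in> \<Omega>" and y: "y \<in> X"
    have "(\<Sum>x\<in>X - {y}. ?W \<eta> y * \<bar>c \<eta> x - c (act y \<eta>) x\<bar> * ?P \<eta> y) =
        (\<Sum>x\<in>X - {y}. \<bar>c \<eta> x - c (act y \<eta>) x\<bar>) * (?W \<eta> y * ?P \<eta> y)"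
      by (simp add: sum_distrib_left sum_distrib_right mult_ac)
    also have "\<dots> \<le> K * (?W \<eta> y * ?P \<eta> y)"
      using \<eta> y f act_in by (intro mult_right_mono variation mult_nonneg_nonneg[OF W] Phi_nonneg) auto
    finally show "(\<Sum>x\<in>X - {y}. ?W \<eta> y * \<bar>c \<eta> x - c (act y \<eta>) x\<bar> * ?P \<eta> y) \<le> K * (?W \<eta> y * ?P \<eta> y)" .
  qed
  also have "\<dots> = 2 * K * fisher \<phi> f"
    by (simp add: fisher_def sum_distrib_left[symmetric])
  finally have B: "(\<Sum>\<eta>\<in>\<Omega>. \<Sum>x\<in>X. \<Sum>y\<in>X - {x}. ?B \<eta> x y) \<le> 2 * K * fisher \<phi> f" .
  have "- (2 * (l * (2 - K) + 2 * u * (r - K))) * fisher \<phi> f = 2 * K * fisher \<phi> f - 2 * ?k * fisher \<phi> f"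
    by (simp add: algebra_simps)
  with *[unfolded A] B show ?thesis by linarith
qed

end

section \<open>From decay of the Fisher information to the entropy inequality\<close>

text \<open>Tychonoff's theorem, for the product topology carried by the function type.\<close>

lemma compact_box_fun: "compact {g :: 's \<Rightarrow> real. \<forall>\<eta>. g \<eta> \<in> {a..b}}"
proof -
  have "compactin (product_topology (\<lambda>_ :: 's. euclideanreal) UNIV) (PiE UNIV (\<lambda>_. {a..b}))"
    by (subst compactin_PiE) (auto simp: compactin_euclidean_iff)
  moreover have "PiE UNIV (\<lambda>_. {a..b}) = {g :: 's \<Rightarrow> real. \<forall>\<eta>. g \<eta> \<in> {a..b}}"
    by (auto simp: PiE_UNIV_domain)
  ultimately show ?thesis
    by (simp add: euclidean_product_topology compactin_euclidean_iff)
qed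

lemma phi_entropy_cong: "(\<And>\<eta>. \<eta> \<in> \<Omega> \<Longrightarrow> f \<eta> = g \<eta>) \<Longrightarrow> phi_entropy \<Omega> m \<phi> f = phi_entropy \<Omega> m \<phi> g"
  by (simp add: phi_entropy_def)

context flip_dynamics
begin

lemma fisher_cong: "(\<And>\<eta>. \<eta> \<in> \<Omega> \<Longrightarrow> f \<eta> = g \<eta>) \<Longrightarrow> fisher \<phi> f = fisher \<phi> g"
  by (simp add: fisher_def act_in)

lemma mean_pos:
  assumes "\<And>\<eta>. \<eta> \<in> \<Omega> \<Longrightarrow> 0 < f \<eta>"
  shows "0 < (\<Sum>\<eta>\<in>\<Omega>. f \<eta> * m \<eta>)"
proof -
  have "\<Omega> \<noteq> {}" using m_sum by auto
  then show ?thesis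
    using finite_\<Omega> assms m_pos by (intro sum_pos) auto
qed

text \<open>If \<open>h\<close> times the total jump rate is at most \<open>1\<close>, the Euler
  step is a convex combination of \<open>f \<eta>\<close> and the values
  \<open>f (act x \<eta>)\<close>.\<close>

lemma gen_step_in_box:
  assumes f: "\<And>\<eta>. \<eta> \<in> \<Omega> \<Longrightarrow> f \<eta> \<in> {a..b}"
  obtains \<delta> where "0 < \<delta>"
    and "\<And>h \<eta>. 0 < h \<Longrightarrow> h < \<delta> \<Longrightarrow> \<eta> \<in> \<Omega> \<Longrightarrow> f \<eta> + h * gen f \<eta> \<in> {a..b}"
proof
  \<comment> \<open>The sum of all rates dominates the jump rate at each state; the added
    \<open>1\<close> keeps \<open>C\<close> positive even without sites.\<close>
  define C where "C = 1 + (\<Sum>\<eta>\<in>\<Omega>. \<Sum>x\<in>X. c \<eta> x)"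
  have C: "0 < C"
    unfolding C_def using c_pos by (intro add_pos_nonneg sum_nonneg) (auto simp: less_imp_le)
  then show "0 < 1 / C" by simp
  fix h \<eta> assume h: "0 < h" "h < 1 / C" and \<eta>: "\<eta> \<in> \<Omega>"
  define q where "q = (\<Sum>x\<in>X. c \<eta> x)"
  have q: "0 \<le> q" unfolding q_def using c_pos by (intro sum_nonneg) (auto simp: less_imp_le)
  have "q \<le> (\<Sum>\<eta>\<in>\<Omega>. \<Sum>x\<in>X. c \<eta> x)"
    unfolding q_def using finite_\<Omega> \<eta> c_pos
    by (intro member_le_sum[of \<eta> \<Omega> "\<lambda>\<eta>. \<Sum>x\<in>X. c \<eta> x"]) (auto intro!: sum_nonneg simp: less_imp_le)
  then have "h * q \<le> h * C"
    using h by (intro mult_left_mono) (auto simp: C_def)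
  also have "\<dots> \<le> 1"
    using h C by (simp add: field_simps)
  finally have hq: "h * q \<le> 1" .
  have "q * (a - f \<eta>) \<le> gen f \<eta>" "gen f \<eta> \<le> q * (b - f \<eta>)"
    unfolding gen_def q_def sum_distrib_right using c_pos f act_in \<eta>
    by (auto intro!: sum_mono mult_left_mono simp: less_imp_le)
  then have "h * (q * (a - f \<eta>)) \<le> h * gen f \<eta>" "h * gen f \<eta> \<le> h * (q * (b - f \<eta>))"
    using h by (auto intro: mult_left_mono)
  moreover have "(h * q) * (f \<eta> - a) \<le> 1 * (f \<eta> - a)" "(h * q) * (b - f \<eta>) \<le> 1 * (b - f \<eta>)"
    using hq f[OF \<eta>] by (intro mult_right_mono; simp)+
  moreover have "h * (q * (a - f \<eta>)) = - ((h * q) * (f \<eta> - a))" "h * (q * (b - f \<eta>)) = (h * q) * (b - f \<eta>)"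
    by (simp_all add: algebra_simps)
  ultimately show "f \<eta> + h * gen f \<eta> \<in> {a..b}" by auto
qed

end

section \<open>Entropy and Fisher information in the direction of the generator\<close>

context convex_flip_dynamics
begin

lemma fisher_has_derivative:
  assumes "\<And>\<eta>. \<eta> \<in> \<Omega> \<Longrightarrow> 0 < f \<eta>"
  shows "((\<lambda>h. fisher \<phi> (\<lambda>\<eta>. f \<eta> + h * gen f \<eta>)) has_real_derivative
    1 / 2 * (\<Sum>\<eta>\<in>\<Omega>. \<Sum>x\<in>X. m \<eta> * c \<eta> x *
      Phi_deriv \<phi> (f \<eta>) (f (act x \<eta>)) (gen f \<eta>) (gen f (act x \<eta>)))) (at 0)"
  unfolding fisher_def
  by (intro DERIV_cmult DERIV_sum Phi_has_derivative[where h = 0, simplified] deriv_differentiable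
      assms act_in)

text \<open>The generator preserves the mean, so \<open>\<phi>\<close> of the mean stays constant;
  summation by parts handles the rest.\<close>

lemma entropy_has_derivative:
  assumes f: "\<And>\<eta>. \<eta> \<in> \<Omega> \<Longrightarrow> 0 < f \<eta>"
  shows "((\<lambda>h. phi_entropy \<Omega> m \<phi> (\<lambda>\<eta>. f \<eta> + h * gen f \<eta>)) has_real_derivative - fisher \<phi> f) (at 0)"
proof -
  let ?M = "\<Sum>\<eta>\<in>\<Omega>. f \<eta> * m \<eta>"
  have mean: "(\<Sum>\<eta>\<in>\<Omega>. (f \<eta> + h * gen f \<eta>) * m \<eta>) = ?M" for h
    using sum_gen[of f] by (simp add: distrib_right sum.distrib mult.assoc sum_distrib_left[symmetric])
  have "((\<lambda>h. \<phi> (f \<eta> + h * gen f \<eta>)) has_real_derivative deriv \<phi> (f \<eta>) * gen f \<eta>) (at 0)"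
    if "\<eta> \<in> \<Omega>" for \<eta>
    by (rule DERIV_chain2[where f = \<phi>])
      (use has_derivs(1)[OF f[OF that]] in \<open>auto intro!: derivative_eq_intros\<close>)
  then have "((\<lambda>h. (\<Sum>\<eta>\<in>\<Omega>. \<phi> (f \<eta> + h * gen f \<eta>) * m \<eta>) - \<phi> ?M) has_real_derivative
      (\<Sum>\<eta>\<in>\<Omega>. deriv \<phi> (f \<eta>) * gen f \<eta> * m \<eta>) - 0) (at 0)"
    by (intro DERIV_diff DERIV_sum DERIV_cmult_right DERIV_const)
  moreover have "(\<Sum>\<eta>\<in>\<Omega>. deriv \<phi> (f \<eta>) * gen f \<eta> * m \<eta>) = - fisher \<phi> f"
    by (simp add: sum_by_parts fisher_def Phi_def)
  ultimately show ?thesis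
    by (simp add: phi_entropy_def mean)
qed

text \<open>Vanishing Fisher information makes \<open>deriv \<phi> (f \<eta>)\<close> constant,
  though not necessarily \<open>f\<close>, as \<open>\<phi>\<close> may be affine on an interval.
  The tangents at the values \<open>f \<eta>\<close> thus share one slope, and comparing them at the
  mean and averaging gives the bound.\<close>

lemma entropy_le_0:
  assumes f: "\<And>\<eta>. \<eta> \<in> \<Omega> \<Longrightarrow> 0 < f \<eta>" and 0: "fisher \<phi> f = 0"
  shows "phi_entropy \<Omega> m \<phi> f \<le> 0"
proof -
  define M where "M = (\<Sum>\<eta>\<in>\<Omega>. f \<eta> * m \<eta>)"
  have M: "0 < M" unfolding M_def using f by (rule mean_pos)
  have nonneg: "0 \<le> m \<eta> * c \<eta> x * Phi \<phi> (f \<eta>) (f (act x \<eta>))" if "\<eta> \<in> \<Omega>" "x \<in> X" for \<eta> x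
    using that c_pos m_pos by (auto intro!: mult_nonneg_nonneg Phi_nonneg f act_in simp: less_imp_le)
  have edge: "deriv \<phi> (f (act x \<eta>)) = deriv \<phi> (f \<eta>)" if "\<eta> \<in> \<Omega>" "x \<in> X" for \<eta> x
  proof -
    have "(\<Sum>\<eta>\<in>\<Omega>. \<Sum>x\<in>X. m \<eta> * c \<eta> x * Phi \<phi> (f \<eta>) (f (act x \<eta>))) = 0"
      using 0 by (simp add: fisher_def)
    then have "\<forall>\<eta>\<in>\<Omega>. (\<Sum>x\<in>X. m \<eta> * c \<eta> x * Phi \<phi> (f \<eta>) (f (act x \<eta>))) = 0"
      by (subst (asm) sum_nonneg_eq_0_iff) (auto intro!: sum_nonneg nonneg finite_\<Omega>)
    then have "(\<Sum>x\<in>X. m \<eta> * c \<eta> x * Phi \<phi> (f \<eta>) (f (act x \<eta>))) = 0"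
      using that by blast
    then have "\<forall>x\<in>X. m \<eta> * c \<eta> x * Phi \<phi> (f \<eta>) (f (act x \<eta>)) = 0"
      by (subst (asm) sum_nonneg_eq_0_iff) (auto intro!: nonneg finite_X that)
    then have "m \<eta> * c \<eta> x * Phi \<phi> (f \<eta>) (f (act x \<eta>)) = 0"
      using that by blast
    then have "Phi \<phi> (f \<eta>) (f (act x \<eta>)) = 0"
      using c_pos[of \<eta> x] m_pos[of \<eta>] by simp
    then show ?thesis by (auto simp: Phi_def)
  qed
  obtain \<eta>0 where \<eta>0: "\<eta>0 \<in> \<Omega>" using m_sum by fastforce
  define k where "k = deriv \<phi> (f \<eta>0)"
  have k: "deriv \<phi> (f \<eta>) = k" if "\<eta> \<in> \<Omega>" for \<eta>
    unfolding k_def by (rule irreducible[of "\<lambda>\<eta>. deriv \<phi> (f \<eta>)", OF edge that \<eta>0])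
  have "(\<Sum>\<eta>\<in>\<Omega>. \<phi> (f \<eta>) * m \<eta>) \<le> (\<Sum>\<eta>\<in>\<Omega>. (\<phi> M + k * (f \<eta> - M)) * m \<eta>)"
  proof (intro sum_mono mult_right_mono less_imp_le[OF m_pos])
    fix \<eta> assume \<eta>: "\<eta> \<in> \<Omega>"
    have "k * (M - f \<eta>) = - (k * (f \<eta> - M))" by (simp add: algebra_simps)
    then show "\<phi> (f \<eta>) \<le> \<phi> M + k * (f \<eta> - M)"
      using tangent[OF f[OF \<eta>] M] k[OF \<eta>] by simp
  qed
  also have "\<dots> = (\<Sum>\<eta>\<in>\<Omega>. (\<phi> M - k * M) * m \<eta>) + (\<Sum>\<eta>\<in>\<Omega>. k * (f \<eta> * m \<eta>))"
    unfolding sum.distrib[symmetric] by (intro sum.cong refl) (simp add: algebra_simps)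
  also have "\<dots> = \<phi> M"
    unfolding sum_distrib_left[symmetric] m_sum M_def[symmetric] by simp
  finally show ?thesis
    by (simp add: phi_entropy_def M_def)
qed

lemma continuous_on_fisher:
  assumes "\<And>g \<eta>. g \<in> S \<Longrightarrow> 0 < g \<eta>"
  shows "continuous_on S (fisher \<phi>)"
proof -
  have [continuous_intros]: "continuous_on S (\<lambda>g. g \<eta>)" for \<eta>
    by (rule continuous_on_subset[OF continuous_on_product_coordinates]) simp
  have [continuous_intros]: "continuous_on S (\<lambda>g. deriv \<phi> (g \<eta>))" for \<eta>
    by (rule continuous_on_compose2[OF continuous_on_deriv]) (use assms in \<open>auto intro: continuous_intros\<close>)
  show ?thesis
    unfolding fisher_def Phi_def by (intro continuous_intros)
qed

lemma continuous_on_entropy: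
  assumes pos: "\<And>g \<eta>. g \<in> S \<Longrightarrow> 0 < g \<eta>"
  shows "continuous_on S (phi_entropy \<Omega> m \<phi>)"
proof -
  have [continuous_intros]: "continuous_on S (\<lambda>g. g \<eta>)" for \<eta>
    by (rule continuous_on_subset[OF continuous_on_product_coordinates]) simp
  have [continuous_intros]: "continuous_on S (\<lambda>g. \<phi> (g \<eta>))" for \<eta>
    by (rule continuous_on_compose2[OF continuous_on_phi]) (use pos in \<open>auto intro: continuous_intros\<close>)
  have [continuous_intros]: "continuous_on S (\<lambda>g. \<phi> (\<Sum>\<eta>\<in>\<Omega>. g \<eta> * m \<eta>))"
    by (rule continuous_on_compose2[OF continuous_on_phi])
      (auto intro!: continuous_intros mean_pos dest: pos)
  show ?thesis
    unfolding phi_entropy_def by (intro continuous_intros)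
qed

text \<open>Replaces the usual integration of the entropy along the semigroup: at a minimiser of
  \<open>fisher - k * entropy\<close> over a box, the derivative in the direction of the generator cannot be
  negative, which forces the Fisher information to vanish there.\<close>

lemma entropy_le_fisher_strict:
  assumes f: "\<And>\<eta>. \<eta> \<in> \<Omega> \<Longrightarrow> 0 < f \<eta>" and k: "0 < k" "k < l * (2 - K) + 2 * u * (r - K)"
  shows "k * phi_entropy \<Omega> m \<phi> f \<le> fisher \<phi> f"
proof -
  let ?F = "\<lambda>g. fisher \<phi> g - k * phi_entropy \<Omega> m \<phi> g"
  have ne: "\<Omega> \<noteq> {}" using m_sum by auto
  define a where "a = Min (f ` \<Omega>)"
  define b where "b = Max (f ` \<Omega>)"
  have a: "0 < a"
    unfolding a_def using finite_\<Omega> ne f by simp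
  have f_in: "f \<eta> \<in> {a..b}" if "\<eta> \<in> \<Omega>" for \<eta>
    unfolding a_def b_def using finite_\<Omega> that by auto
  define S where "S = {g :: 's \<Rightarrow> real. \<forall>\<eta>. g \<eta> \<in> {a..b}}"
  have pos: "0 < g \<eta>" if "g \<in> S" for g \<eta>
  proof -
    have "a \<le> g \<eta>" using that by (auto simp: S_def)
    then show ?thesis using a by linarith
  qed
  \<comment> \<open>The box constrains functions on the whole type, so \<open>f\<close> is given the
    admissible value \<open>a\<close> outside \<Omega>.\<close>
  define f0 where "f0 = (\<lambda>\<eta>. if \<eta> \<in> \<Omega> then f \<eta> else a)"
  have "a \<le> b" using f_in ne by fastforce
  then have f0: "f0 \<in> S" using f_in by (auto simp: f0_def S_def)
  have "compact S" unfolding S_def by (rule compact_box_fun)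
  moreover have "continuous_on S ?F"
    by (intro continuous_intros continuous_on_fisher continuous_on_entropy pos)
  ultimately obtain g where g: "g \<in> S" and min: "\<And>g'. g' \<in> S \<Longrightarrow> ?F g \<le> ?F g'"
    using continuous_attains_inf[of S ?F] f0 by blast
  note g_pos = pos[OF g]
  have fisher_g: "fisher \<phi> g = 0"
  proof (rule ccontr)
    assume "fisher \<phi> g \<noteq> 0"
    then have I: "0 < fisher \<phi> g" using fisher_nonneg[of g] g_pos by force
    let ?G = "\<lambda>h \<eta>. g \<eta> + h * gen g \<eta>"
    let ?D = "1 / 2 * (\<Sum>\<eta>\<in>\<Omega>. \<Sum>x\<in>X. m \<eta> * c \<eta> x *
      Phi_deriv \<phi> (g \<eta>) (g (act x \<eta>)) (gen g \<eta>) (gen g (act x \<eta>)))"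
    have D: "((\<lambda>h. ?F (?G h)) has_real_derivative ?D - k * - fisher \<phi> g) (at 0)"
      by (intro DERIV_diff DERIV_cmult fisher_has_derivative entropy_has_derivative g_pos)
    \<comment> \<open>Here \<open>k\<close> is strictly below the decay rate, so positive Fisher
      information would make the functional decrease along the generator.\<close>
    have "?D + k * fisher \<phi> g \<le> (k - (l * (2 - K) + 2 * u * (r - K))) * fisher \<phi> g"
      using fisher_decay[of g, OF g_pos]
      by (simp only: left_diff_distrib mult_minus_left)
    also have "\<dots> < 0"
      using k I by (intro mult_neg_pos) auto
    finally have "?D - k * - fisher \<phi> g < 0" by simp
    from DERIV_neg_dec_right[OF D this] obtain \<epsilon> where
      \<epsilon>: "0 < \<epsilon>" and dec: "\<And>h. 0 < h \<Longrightarrow> h < \<epsilon> \<Longrightarrow> ?F (?G (0 + h)) < ?F (?G 0)" by blast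
    obtain \<delta> where \<delta>: "0 < \<delta>" and
      box: "\<And>h \<eta>. 0 < h \<Longrightarrow> h < \<delta> \<Longrightarrow> \<eta> \<in> \<Omega> \<Longrightarrow> ?G h \<eta> \<in> {a..b}"
      using gen_step_in_box[of g a b] g by (auto simp: S_def)
    define h where "h = min \<epsilon> \<delta> / 2"
    have h: "0 < h" "h < \<epsilon>" "h < \<delta>" using \<epsilon> \<delta> by (auto simp: h_def)
    \<comment> \<open>The Euler step is known to stay in the box only on \<Omega>, so
      \<open>g\<close> is left unchanged elsewhere.\<close>
    define g' where "g' = (\<lambda>\<eta>. if \<eta> \<in> \<Omega> then ?G h \<eta> else g \<eta>)"
    have "g' \<in> S" using box[OF h(1,3)] g by (auto simp: g'_def S_def)
    then have "?F g \<le> ?F g'" by (rule min)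
    also have "?F g' = ?F (?G h)"
      using fisher_cong[of g' "?G h"] phi_entropy_cong[of \<Omega> g' "?G h"] by (simp add: g'_def)
    finally show False using dec[OF h(1,2)] by simp
  qed
  have "k * phi_entropy \<Omega> m \<phi> g \<le> 0"
    using entropy_le_0[OF g_pos fisher_g] k by (simp add: mult_nonneg_nonpos)
  then have "0 \<le> ?F f0"
    using min[OF f0] fisher_g by simp
  moreover have "?F f0 = ?F f"
    using fisher_cong[of f0 f] phi_entropy_cong[of \<Omega> f0 f] by (simp add: f0_def)
  ultimately show ?thesis by simp
qed

text \<open>The endpoint constant is reached from below as a limit of strict ones;
  \<open>K < 2\<close> makes it positive, so positive constants lie just below it.\<close>

lemma entropy_le_fisher:
  assumes f: "\<And>\<eta>. \<eta> \<in> \<Omega> \<Longrightarrow> 0 < f \<eta>" and "K < 2"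
  shows "(l * (2 - K) + 2 * u * (r - K)) * phi_entropy \<Omega> m \<phi> f \<le> fisher \<phi> f"
proof -
  define k where "k = l * (2 - K) + 2 * u * (r - K)"
  have "0 < k"
    unfolding k_def using assms(2) l_ge_1 u_nonneg K_le by (intro add_pos_nonneg) auto
  have "((\<lambda>t. t * phi_entropy \<Omega> m \<phi> f) \<longlongrightarrow> k * phi_entropy \<Omega> m \<phi> f) (at_left k)"
    by (intro tendsto_intros)
  moreover have "\<forall>\<^sub>F t in at_left k. t * phi_entropy \<Omega> m \<phi> f \<le> fisher \<phi> f"
    using eventually_at_left_real[OF \<open>0 < k\<close>]
    by eventually_elim (rule entropy_le_fisher_strict[OF f], auto simp: k_def)
  ultimately show ?thesis
    unfolding k_def[symmetric] by (rule tendsto_upperbound) simp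
qed

end

section \<open>The Ising model\<close>

lemma nbr_sym: "nbr x y \<longleftrightarrow> nbr y x"
  by (simp add: nbr_def abs_minus_commute)

lemma nbr_irrefl: "\<not> nbr x x"
  by (simp add: nbr_def)

lemma nbrs_finite_card:
  fixes x :: "int ^ 'd"
  shows "finite {y. nbr x y} \<and> card {y. nbr x y} \<le> 2 * CARD('d)"
proof -
  \<comment> \<open>Enumerates the vectors at distance one: a coordinate to change and a sign, hence
    \<open>2 * d\<close> candidates.\<close>
  define F where "F = (\<lambda>(i :: 'd, s :: int). \<chi> j. if j = i then x $ i + s else x $ j)"
  have sub: "{y. nbr x y} \<subseteq> F ` (UNIV \<times> {-1, 1})"
  proof
    fix y assume "y \<in> {y. nbr x y}"
    then have sum: "(\<Sum>i\<in>UNIV. \<bar>x $ i - y $ i\<bar>) = 1" by (simp add: nbr_def)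
    have "\<exists>i. x $ i \<noteq> y $ i"
    proof (rule ccontr)
      assume "\<nexists>i. x $ i \<noteq> y $ i"
      with sum show False by simp
    qed
    then obtain i where "x $ i \<noteq> y $ i" ..
    then have i: "1 \<le> \<bar>x $ i - y $ i\<bar>" by linarith
    have split: "\<bar>x $ i - y $ i\<bar> + (\<Sum>j\<in>UNIV - {i}. \<bar>x $ j - y $ j\<bar>) = 1"
      using sum sum.remove[of UNIV i "\<lambda>j. \<bar>x $ j - y $ j\<bar>"] by simp
    have rest_nonneg: "0 \<le> (\<Sum>j\<in>UNIV - {i}. \<bar>x $ j - y $ j\<bar>)"
      by (intro sum_nonneg) simp
    then have rest: "(\<Sum>j\<in>UNIV - {i}. \<bar>x $ j - y $ j\<bar>) = 0" and "\<bar>x $ i - y $ i\<bar> = 1"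
      using split i by linarith+
    then have s: "y $ i - x $ i \<in> {-1, 1}" by auto
    have "x $ j = y $ j" if "j \<noteq> i" for j
    proof -
      have "\<forall>j\<in>UNIV - {i}. \<bar>x $ j - y $ j\<bar> = 0"
        using rest by (subst (asm) sum_nonneg_eq_0_iff) simp_all
      then show ?thesis using that by simp
    qed
    then have "y = F (i, y $ i - x $ i)"
      by (auto simp: F_def vec_eq_iff)
    with s show "y \<in> F ` (UNIV \<times> {-1, 1})" by blast
  qed
  have "card {y. nbr x y} \<le> card (F ` (UNIV \<times> {-1, 1}))"
    by (intro card_mono sub) simp
  also have "\<dots> \<le> card ((UNIV :: 'd set) \<times> {-1, 1 :: int})"
    by (intro card_image_le) simp
  finally have "card {y. nbr x y} \<le> 2 * CARD('d)"
    by (simp add: card_cartesian_product)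
  moreover have "finite {y. nbr x y}"
    by (rule finite_subset[OF sub]) simp
  ultimately show ?thesis
    by simp
qed

section \<open>Spin flips\<close>

lemma flip_flip: "flip x (flip x \<eta>) = \<eta>"
  by (auto simp: flip_def)

lemma flip_commute: "flip x (flip y \<eta>) = flip y (flip x \<eta>)"
  by (auto simp: flip_def)

lemma flip_in_configs:
  assumes "\<eta> \<in> configs \<Lambda>" "x \<in> \<Lambda>"
  shows "flip x \<eta> \<in> configs \<Lambda>"
proof -
  have "\<eta> x \<in> {-1, 1}" using assms by (auto simp: configs_def PiE_iff)
  then show ?thesis
    using assms by (auto simp: configs_def flip_def PiE_iff extensional_def)
qed

text \<open>Allows a sum over the set of maps \<open>moves \<Lambda>\<close> to be rewritten as a
  sum over sites.\<close>

lemma inj_on_flip: "inj_on flip \<Lambda>"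
proof (rule inj_onI)
  fix x y :: "int ^ 'd" assume "flip x = flip y"
  then have "flip x (\<lambda>_. 1) x = flip y (\<lambda>_. 1) x" by simp
  then show "x = y" by (simp add: flip_def split: if_splits)
qed

lemma configs_abs:
  assumes "\<eta> \<in> configs \<Lambda>" "x \<in> \<Lambda>"
  shows "\<bar>\<eta> x\<bar> = 1"
  using assms by (auto simp: configs_def PiE_iff)

text \<open>Irreducibility: one configuration is changed into the other site by site, with a flip
  exactly where they differ.\<close>

lemma flip_invariant_const:
  assumes "finite \<Lambda>" and inv: "\<And>\<eta> x. \<eta> \<in> configs \<Lambda> \<Longrightarrow> x \<in> \<Lambda> \<Longrightarrow> g (flip x \<eta>) = g \<eta>"
    and \<eta>: "\<eta> \<in> configs \<Lambda>" and \<eta>': "\<eta>' \<in> configs \<Lambda>"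
  shows "g \<eta> = g \<eta>'"
proof -
  let ?\<xi> = "\<lambda>A x. if x \<in> A then \<eta>' x else \<eta> x"
  have "?\<xi> A \<in> configs \<Lambda> \<and> g (?\<xi> A) = g \<eta>" if "finite A" "A \<subseteq> \<Lambda>" for A
    using that
  proof (induction A)
    case empty
    then show ?case using \<eta> by simp
  next
    case (insert a A)
    then have IH: "?\<xi> A \<in> configs \<Lambda>" "g (?\<xi> A) = g \<eta>" and a: "a \<in> \<Lambda>" by auto
    show ?case
    proof (cases "\<eta>' a = \<eta> a")
      case True
      then have "?\<xi> (insert a A) = ?\<xi> A" by auto
      with IH show ?thesis by simp
    next
      case False
      then have "\<eta>' a = - \<eta> a"
        using configs_abs[OF \<eta> a] configs_abs[OF \<eta>' a] by auto
      then have "?\<xi> (insert a A) = flip a (?\<xi> A)"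
        using insert.hyps by (auto simp: flip_def)
      then show ?thesis
        using flip_in_configs[OF IH(1) a] inv[OF IH(1) a] IH(2) by simp
    qed
  qed
  from this[of \<Lambda>] have "g (?\<xi> \<Lambda>) = g \<eta>" using assms(1) by simp
  moreover have "?\<xi> \<Lambda> = \<eta>'"
    using \<eta> \<eta>' by (auto simp: configs_def PiE_iff extensional_def)
  ultimately show ?thesis by simp
qed

section \<open>Local fields and flip rates\<close>

definition field :: "(int ^ 'd) set \<Rightarrow> int ^ 'd \<Rightarrow> 'd config \<Rightarrow> real" where
  "field \<Lambda> x \<eta> = (\<Sum>y | y \<in> \<Lambda> \<and> nbr x y. \<eta> y)"

lemma hamiltonian_flip:
  assumes "finite \<Lambda>" and x: "x \<in> \<Lambda>"
  shows "hamiltonian \<Lambda> (flip x \<eta>) - hamiltonian \<Lambda> \<eta> = 2 * \<eta> x * field \<Lambda> x \<eta>"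
proof -
  let ?J = "\<lambda>u v. if nbr u v then 1 else 0 :: real"
  have H: "hamiltonian \<Lambda> \<xi> = - (1 / 2) * (\<Sum>u\<in>\<Lambda>. \<Sum>v\<in>\<Lambda>. ?J u v * (\<xi> u * \<xi> v))" for \<xi>
  proof -
    have "{(u, v). u \<in> \<Lambda> \<and> v \<in> \<Lambda> \<and> nbr u v} = {p \<in> \<Lambda> \<times> \<Lambda>. nbr (fst p) (snd p)}" by auto
    then have "(\<Sum>(u, v) | u \<in> \<Lambda> \<and> v \<in> \<Lambda> \<and> nbr u v. \<xi> u * \<xi> v) =
        (\<Sum>p\<in>\<Lambda> \<times> \<Lambda>. if nbr (fst p) (snd p) then \<xi> (fst p) * \<xi> (snd p) else 0)"
      using assms(1) by (simp only: sum.inter_filter finite_cartesian_product case_prod_unfold)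
    also have "\<dots> = (\<Sum>u\<in>\<Lambda>. \<Sum>v\<in>\<Lambda>. ?J u v * (\<xi> u * \<xi> v))"
      by (subst sum.cartesian_product) (intro sum.cong refl, auto)
    finally show ?thesis unfolding hamiltonian_def by simp
  qed
  have field: "field \<Lambda> x \<eta> = (\<Sum>v\<in>\<Lambda>. ?J x v * \<eta> v)"
    unfolding field_def using assms(1) by (subst sum.inter_filter) (auto intro!: sum.cong)
  \<comment> \<open>Only the row and the column of \<open>x\<close> change sign; their common entry
    vanishes because no site neighbours itself, so the two corrections simply add.\<close>
  have "(\<Sum>u\<in>\<Lambda>. \<Sum>v\<in>\<Lambda>. ?J u v * (flip x \<eta> u * flip x \<eta> v)) - (\<Sum>u\<in>\<Lambda>. \<Sum>v\<in>\<Lambda>. ?J u v * (\<eta> u * \<eta> v)) =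
      (\<Sum>u\<in>\<Lambda>. \<Sum>v\<in>\<Lambda>. (if u = x then - 2 * \<eta> x * (?J x v * \<eta> v) else 0)
        + (if v = x then - 2 * \<eta> x * (?J x u * \<eta> u) else 0))"
    unfolding sum_subtractf[symmetric]
    by (intro sum.cong refl) (auto simp: flip_def nbr_irrefl nbr_sym[of x])
  also have "\<dots> = (\<Sum>u\<in>\<Lambda>. if u = x then \<Sum>v\<in>\<Lambda>. - 2 * \<eta> x * (?J x v * \<eta> v) else 0)
      + (\<Sum>u\<in>\<Lambda>. - 2 * \<eta> x * (?J x u * \<eta> u))"
    unfolding sum.distrib using assms
    by (intro arg_cong2[where f = "(+)"] sum.cong) auto
  also have "\<dots> = - 4 * \<eta> x * field \<Lambda> x \<eta>"
    using assms unfolding field sum_distrib_left[symmetric] by simp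
  finally show ?thesis
    unfolding H by (simp add: algebra_simps)
qed

lemma rate_flip:
  assumes "finite \<Lambda>" "x \<in> \<Lambda>"
  shows "rate \<Lambda> \<beta> \<eta> (flip x) = exp (- (\<beta> * (\<eta> x * field \<Lambda> x \<eta>)))"
  by (simp add: rate_def hamiltonian_flip[OF assms])

lemma field_bound:
  fixes \<Lambda> :: "(int ^ 'd) set"
  assumes "\<eta> \<in> configs \<Lambda>" "x \<in> \<Lambda>"
  shows "\<bar>\<eta> x * field \<Lambda> x \<eta>\<bar> \<le> 2 * real CARD('d)"
proof -
  have "\<bar>field \<Lambda> x \<eta>\<bar> \<le> (\<Sum>y | y \<in> \<Lambda> \<and> nbr x y. \<bar>\<eta> y\<bar>)"
    unfolding field_def by (rule sum_abs)
  also have "\<dots> = real (card {y. y \<in> \<Lambda> \<and> nbr x y})"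
    using configs_abs[OF assms(1)] by simp
  also have "card {y. y \<in> \<Lambda> \<and> nbr x y} \<le> card {y. nbr x y}"
    using nbrs_finite_card[of x] by (intro card_mono) auto
  also have "\<dots> \<le> 2 * CARD('d)"
    using nbrs_finite_card[of x] by simp
  finally show ?thesis
    by (simp add: abs_mult configs_abs[OF assms])
qed

lemma rate_bounds:
  fixes \<Lambda> :: "(int ^ 'd) set"
  assumes "finite \<Lambda>" "\<eta> \<in> configs \<Lambda>" "x \<in> \<Lambda>" "0 < \<beta>"
  shows "exp (- 2 * \<beta> * real CARD('d)) \<le> rate \<Lambda> \<beta> \<eta> (flip x)"
    and "rate \<Lambda> \<beta> \<eta> (flip x) \<le> exp (2 * \<beta> * real CARD('d))"
proof -
  have "\<beta> * (\<eta> x * field \<Lambda> x \<eta>) \<le> \<beta> * (2 * real CARD('d))"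
    "\<beta> * - (\<eta> x * field \<Lambda> x \<eta>) \<le> \<beta> * (2 * real CARD('d))"
    using field_bound[OF assms(2,3)] assms(4) by (intro mult_left_mono; simp)+
  then show "exp (- 2 * \<beta> * real CARD('d)) \<le> rate \<Lambda> \<beta> \<eta> (flip x)"
    and "rate \<Lambda> \<beta> \<eta> (flip x) \<le> exp (2 * \<beta> * real CARD('d))"
    unfolding rate_flip[OF assms(1,3)] exp_le_cancel_iff by (simp_all add: mult_ac del: mult_le_cancel_left)
qed

lemma field_flip:
  assumes "finite \<Lambda>" "x \<in> \<Lambda>"
  shows "field \<Lambda> y (flip x \<eta>) = field \<Lambda> y \<eta> - (if nbr y x then 2 * \<eta> x else 0)"
proof -
  have "(\<Sum>z | z \<in> \<Lambda> \<and> nbr y z. flip x \<eta> z - \<eta> z) =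
      (\<Sum>z | z \<in> \<Lambda> \<and> nbr y z. if z = x then - 2 * \<eta> x else 0)"
    by (intro sum.cong) (auto simp: flip_def)
  then show ?thesis
    using assms by (simp add: field_def sum_subtractf split: if_splits)
qed

text \<open>Factoring out \<open>exp p\<close>, rather than using the mean value theorem, produces
  the factor \<open>1 - exp (- \<delta>)\<close> that enters \<open>K\<close>.\<close>

lemma exp_diff_le:
  fixes p q \<delta> B :: real
  assumes "exp p \<le> B" "exp q \<le> B" "\<bar>p - q\<bar> \<le> \<delta>"
  shows "\<bar>exp p - exp q\<bar> \<le> (1 - exp (- \<delta>)) * B"
proof -
  have *: "exp p - exp q \<le> (1 - exp (- \<delta>)) * B" if "exp p \<le> B" "\<bar>p - q\<bar> \<le> \<delta>" for p q
  proof -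
    have "exp p * exp (- \<delta>) \<le> exp q"
      unfolding exp_add[symmetric] using that by simp
    then have "exp p - exp q \<le> (1 - exp (- \<delta>)) * exp p"
      by (simp add: algebra_simps)
    also have "\<dots> \<le> (1 - exp (- \<delta>)) * B"
      using that by (intro mult_left_mono) auto
    finally show ?thesis .
  qed
  from *[of p q] *[of q p] assms show ?thesis by (simp add: abs_le_iff abs_minus_commute)
qed

text \<open>Only neighbours of \<open>x\<close> feel the flip, at most \<open>2 * d\<close> of them,
  and for each the exponent of the rate moves by \<open>2 * \<beta>\<close> in absolute
  value.\<close>

lemma rate_variation:
  fixes \<Lambda> :: "(int ^ 'd) set"
  assumes \<Lambda>: "finite \<Lambda>" and \<eta>: "\<eta> \<in> configs \<Lambda>" and x: "x \<in> \<Lambda>" and \<beta>: "0 < \<beta>"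
  shows "(\<Sum>y\<in>\<Lambda> - {x}. \<bar>rate \<Lambda> \<beta> \<eta> (flip y) - rate \<Lambda> \<beta> (flip x \<eta>) (flip y)\<bar>)
    \<le> 2 * real CARD('d) * (1 - exp (- 2 * \<beta>)) * exp (2 * \<beta> * real CARD('d))"
proof -
  let ?k = "(1 - exp (- (2 * \<beta>))) * exp (2 * \<beta> * real CARD('d))"
  have k: "0 \<le> ?k" using \<beta> by simp
  have "(\<Sum>y\<in>\<Lambda> - {x}. \<bar>rate \<Lambda> \<beta> \<eta> (flip y) - rate \<Lambda> \<beta> (flip x \<eta>) (flip y)\<bar>)
      \<le> (\<Sum>y\<in>\<Lambda> - {x}. if nbr x y then ?k else 0)"
  proof (rule sum_mono)
    fix y assume "y \<in> \<Lambda> - {x}"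
    then have y: "y \<in> \<Lambda>" "y \<noteq> x" by auto
    have \<eta>y: "flip x \<eta> y = \<eta> y" using y by (simp add: flip_def)
    show "\<bar>rate \<Lambda> \<beta> \<eta> (flip y) - rate \<Lambda> \<beta> (flip x \<eta>) (flip y)\<bar> \<le> (if nbr x y then ?k else 0)"
    proof (cases "nbr x y")
      case True
      let ?p = "- (\<beta> * (\<eta> y * field \<Lambda> y \<eta>))"
      let ?q = "- (\<beta> * (flip x \<eta> y * field \<Lambda> y (flip x \<eta>)))"
      have "?p - ?q = - (2 * \<beta> * (\<eta> y * \<eta> x))"
        unfolding \<eta>y field_flip[OF \<Lambda> x] using True by (simp add: nbr_sym algebra_simps)
      then have "\<bar>?p - ?q\<bar> \<le> 2 * \<beta>"
        using \<beta> configs_abs[OF \<eta> x] configs_abs[OF \<eta> y(1)] by (simp add: abs_mult)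
      then show ?thesis
        using exp_diff_le[of ?p _ ?q "2 * \<beta>"] rate_bounds(2)[OF \<Lambda> \<eta> y(1) \<beta>] True
          rate_bounds(2)[OF \<Lambda> flip_in_configs[OF \<eta> x] y(1) \<beta>]
        unfolding rate_flip[OF \<Lambda> y(1)] by simp
    next
      case False
      then show ?thesis
        unfolding rate_flip[OF \<Lambda> y(1)] \<eta>y field_flip[OF \<Lambda> x] by (simp add: nbr_sym)
    qed
  qed
  also have "\<dots> = real (card {y \<in> \<Lambda> - {x}. nbr x y}) * ?k"
    using \<Lambda> by (simp add: sum.inter_filter[symmetric])
  also have "\<dots> \<le> real (2 * CARD('d)) * ?k"
  proof (intro mult_right_mono k of_nat_mono)
    have "card {y \<in> \<Lambda> - {x}. nbr x y} \<le> card {y. nbr x y}"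
      using nbrs_finite_card[of x] by (intro card_mono) auto
    then show "card {y \<in> \<Lambda> - {x}. nbr x y} \<le> 2 * CARD('d)"
      using nbrs_finite_card[of x] by simp
  qed
  finally show ?thesis by (simp add: mult.assoc)
qed

section \<open>The Glauber dynamics as an instance of flip dynamics\<close>

lemma glauber_flip_dynamics:
  fixes \<Lambda> :: "(int ^ 'd) set" and d :: real
  assumes \<Lambda>: "finite \<Lambda>" and \<beta>: "0 < \<beta>" and d: "d = real CARD('d)"
    and small: "2 * d * (1 - exp (- 2 * \<beta>)) * exp (4 * d * \<beta>) \<le> 1"
  shows "flip_dynamics (configs \<Lambda>) \<Lambda> flip (\<lambda>\<eta> x. rate \<Lambda> \<beta> \<eta> (flip x)) (gibbs \<Lambda> \<beta>)
    (exp (- 2 * \<beta> * d)) (2 * d * (1 - exp (- 2 * \<beta>)) * exp (2 * \<beta> * d))"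
proof
  show fin: "finite (configs \<Lambda>)"
    unfolding configs_def using \<Lambda> by (intro finite_PiE) auto
  have "(\<lambda>x\<in>\<Lambda>. 1) \<in> configs \<Lambda>" by (auto simp: configs_def)
  then have Z: "0 < partition_fun \<Lambda> \<beta>"
    unfolding partition_fun_def using fin by (intro sum_pos) auto
  then show "0 < gibbs \<Lambda> \<beta> \<eta>" for \<eta>
    by (simp add: gibbs_def)
  show "sum (gibbs \<Lambda> \<beta>) (configs \<Lambda>) = 1"
    unfolding gibbs_def sum_distrib_left[symmetric] partition_fun_def[symmetric] using Z by simp
  show "0 < rate \<Lambda> \<beta> \<eta> (flip x)" for \<eta> x
    by (simp add: rate_def)
  \<comment> \<open>Up to normalisation both sides are the exponential of
    \<open>- \<beta> / 2\<close> times the sum of the energies at the two ends.\<close>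
  show "gibbs \<Lambda> \<beta> \<eta> * rate \<Lambda> \<beta> \<eta> (flip x) =
      gibbs \<Lambda> \<beta> (flip x \<eta>) * rate \<Lambda> \<beta> (flip x \<eta>) (flip x)" for \<eta> x
    by (simp add: gibbs_def rate_def flip_flip exp_add[symmetric] field_simps)
  show "rate \<Lambda> \<beta> \<eta> (flip y) * rate \<Lambda> \<beta> (flip y \<eta>) (flip x) =
      rate \<Lambda> \<beta> \<eta> (flip x) * rate \<Lambda> \<beta> (flip x \<eta>) (flip y)" for \<eta> x y
    by (simp add: rate_def flip_commute[of x y] exp_add[symmetric] algebra_simps)
  show "2 \<le> rate \<Lambda> \<beta> \<eta> (flip x) + rate \<Lambda> \<beta> (flip x \<eta>) (flip x)" for \<eta> x
  proof -
    \<comment> \<open>The rates of a flip and of its reverse are reciprocal, so their sum is at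
      least \<open>2\<close>.\<close>
    define t where "t = - (\<beta> / 2) * (hamiltonian \<Lambda> (flip x \<eta>) - hamiltonian \<Lambda> \<eta>)"
    have "rate \<Lambda> \<beta> \<eta> (flip x) = exp t" "rate \<Lambda> \<beta> (flip x \<eta>) (flip x) = exp (- t)"
      by (simp_all add: rate_def t_def flip_flip algebra_simps)
    with exp_ge_add_one_self[of t] exp_ge_add_one_self[of "- t"] show ?thesis by linarith
  qed
  \<comment> \<open>The smallness assumption, multiplied by \<open>exp (- 2 * \<beta> * d)\<close>,
    is precisely \<open>K \<le> r\<close>.\<close>
  show "2 * d * (1 - exp (- 2 * \<beta>)) * exp (2 * \<beta> * d) \<le> exp (- 2 * \<beta> * d)"
  proof -
    have "2 * d * (1 - exp (- 2 * \<beta>)) * exp (2 * \<beta> * d) =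
        2 * d * (1 - exp (- 2 * \<beta>)) * exp (4 * d * \<beta>) * exp (- 2 * \<beta> * d)"
      unfolding mult.assoc exp_add[symmetric] by (simp add: algebra_simps)
    also have "\<dots> \<le> 1 * exp (- 2 * \<beta> * d)"
      by (intro mult_right_mono small) simp
    finally show ?thesis by simp
  qed
  show "g \<eta> = g \<eta>'"
    if "\<And>\<eta> x. \<eta> \<in> configs \<Lambda> \<Longrightarrow> x \<in> \<Lambda> \<Longrightarrow> g (flip x \<eta>) = g \<eta>"
      "\<eta> \<in> configs \<Lambda>" "\<eta>' \<in> configs \<Lambda>" for g :: "'d config \<Rightarrow> real" and \<eta> \<eta>'
    using \<Lambda> that by (rule flip_invariant_const)
  show "exp (- 2 * \<beta> * d) \<le> rate \<Lambda> \<beta> \<eta> (flip x)" if "\<eta> \<in> configs \<Lambda>" "x \<in> \<Lambda>" for \<eta> x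
    unfolding d using \<Lambda> that \<beta> by (rule rate_bounds)
  show "(\<Sum>y\<in>\<Lambda> - {x}. \<bar>rate \<Lambda> \<beta> \<eta> (flip y) - rate \<Lambda> \<beta> (flip x \<eta>) (flip y)\<bar>)
      \<le> 2 * d * (1 - exp (- 2 * \<beta>)) * exp (2 * \<beta> * d)" if "\<eta> \<in> configs \<Lambda>" "x \<in> \<Lambda>" for \<eta> x
    unfolding d using \<Lambda> that \<beta> by (rule rate_variation)
qed (fact \<Lambda> flip_in_configs flip_flip flip_commute)+

theorem theorem4p3:
  fixes \<Lambda> :: "(int ^ 'd) set" and \<beta> d \<kappa> \<kappa>' :: real
  assumes "finite \<Lambda>"
    and "lattice_connected \<Lambda>"
    and "0 < \<beta>"
    and "d = real CARD('d)"
    and "2 * d * (1 - exp (- 2 * \<beta>)) * exp (4 * d * \<beta>) \<le> 1"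
    and "\<kappa> = 2 - 2 * d * (1 - exp (- 2 * \<beta>)) * exp (2 * \<beta> * d)"
    and "\<kappa>' = exp (- 2 * \<beta> * d) - 2 * d * (1 - exp (- 2 * \<beta>)) * exp (2 * \<beta> * d)"
  shows "(\<forall>\<phi>. admissible \<phi> \<longrightarrow>
            convex_sobolev (configs \<Lambda>) (moves \<Lambda>) (rate \<Lambda> \<beta>) (gibbs \<Lambda> \<beta>) \<phi> \<kappa>)
    \<and> modified_log_sobolev (configs \<Lambda>) (moves \<Lambda>) (rate \<Lambda> \<beta>) (gibbs \<Lambda> \<beta>) (\<kappa> + 2 * \<kappa>')
    \<and> (\<forall>\<alpha>\<in>{1<..2}. beckner (configs \<Lambda>) (moves \<Lambda>) (rate \<Lambda> \<beta>) (gibbs \<Lambda> \<beta>) \<alpha> (\<alpha> * \<kappa>))"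
proof -
  define K where "K = 2 * d * (1 - exp (- 2 * \<beta>)) * exp (2 * \<beta> * d)"
  define r where "r = exp (- 2 * \<beta> * d)"
  have \<kappa>: "\<kappa> = 2 - K" "\<kappa>' = r - K" using assms(6,7) by (simp_all add: K_def r_def)
  interpret flip_dynamics "configs \<Lambda>" \<Lambda> flip "\<lambda>\<eta> x. rate \<Lambda> \<beta> \<eta> (flip x)" "gibbs \<Lambda> \<beta>" r K
    unfolding K_def r_def using assms by (intro glauber_flip_dynamics)
  have "r \<le> 1" unfolding r_def using assms(3,4) by simp
  then have K: "K < 2" using K_le by linarith
  \<comment> \<open>The three claims are the cases \<open>(l, u) = (1, 0)\<close>,
    \<open>(1, 1)\<close> and \<open>(\<alpha>, 0)\<close> of this single inequality.\<close>
  have sobolev: "convex_sobolev (configs \<Lambda>) (moves \<Lambda>) (rate \<Lambda> \<beta>) (gibbs \<Lambda> \<beta>) \<phi>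
      (l * \<kappa> + 2 * u * \<kappa>')" if "Phi_bounds \<phi> l u" for \<phi> l u
  proof -
    interpret Phi_bounds \<phi> l u by (rule that)
    interpret convex_flip_dynamics "configs \<Lambda>" \<Lambda> flip "\<lambda>\<eta> x. rate \<Lambda> \<beta> \<eta> (flip x)"
      "gibbs \<Lambda> \<beta>" r K \<phi> l u ..
    show ?thesis
      using entropy_le_fisher K
      by (simp add: convex_sobolev_def moves_def sum.reindex[OF inj_on_flip] fisher_def \<kappa> mult_ac)
  qed
  have "convex_sobolev (configs \<Lambda>) (moves \<Lambda>) (rate \<Lambda> \<beta>) (gibbs \<Lambda> \<beta>) \<phi> \<kappa>"
    if "admissible \<phi>" for \<phi>
    using sobolev[OF Phi_bounds_admissible[OF that]] by simp
  moreover have "modified_log_sobolev (configs \<Lambda>) (moves \<Lambda>) (rate \<Lambda> \<beta>) (gibbs \<Lambda> \<beta>) (\<kappa> + 2 * \<kappa>')"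
    using sobolev[OF Phi_bounds_log] by (simp add: modified_log_sobolev_def)
  moreover have "beckner (configs \<Lambda>) (moves \<Lambda>) (rate \<Lambda> \<beta>) (gibbs \<Lambda> \<beta>) \<alpha> (\<alpha> * \<kappa>)"
    if "\<alpha> \<in> {1<..2}" for \<alpha>
    using sobolev[OF Phi_bounds_power[of \<alpha>]] that by (simp add: beckner_def)
  ultimately show ?thesis by blast
qed

end
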